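(* Let $n,d\ge 2$ be integers and let $\mathbb{F}$ be a finite field with $\#\mathbb{F}=n-1$. Then for every infinite field $\mathbb{L}$ with $\operatorname{char}\mathbb{L}=\operatorname{char}\mathbb{F}$ we have $C_{n,d}^{\mathbb{L}}\le C_{n,d}^{\mathbb{F}}\le C_{n,d}^{\mathbb{L}}+1$.
   Context: $\langle X\rangle_d$ is the free semigroup (without unity) on letters $x_1,\dots,x_d$; for a field $\mathbb{K}$, $\mathbb{K}\langle X\rangle_d$ is the semigroup algebra, i.e. the free associative non-unital $\mathbb{K}$-algebra on $x_1,\dots,x_d$. Define $N_{n,d}^{\mathbb{K}}=\mathbb{K}\langle X\rangle_d/\mathrm{id}\{x^n\mid x\in\mathbb{K}\langle X\rangle_d\}$, the quotient by the two-sided ideal generated by all $n$-th powers of elements. It is a nilpotent algebra, and $C_{n,d}^{\mathbb{K}}=\min\{c>0\mid a_1\cdots a_c=0\text{ for all }a_1,\dots,a_c\in N_{n,d}^{\mathbb{K}}\}$ is its nilpotency degree. $\#\mathbb{F}$ denotes the cardinality of $\mathbb{F}$. *)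

theory Defs
  imports HOL.Hull "HOL-Library.Cardinality" "HOL-Library.Poly_Mapping"
begin

text \<open>
  The letters of words are natural numbers. The free monoid of words, written additively, is an
  instance of \<^class>\<open>monoid_add\<close>, so that \<open>nat fmonoid \<Rightarrow>\<^sub>0 'k\<close>, with the convolution product of
  \<^theory>\<open>HOL-Library.Poly_Mapping\<close>, is the unital free associative algebra. The free algebra without
  unity on \<open>x\<^sub>1, \<dots>, x\<^sub>d\<close> is the subset of elements supported on the free semigroup of
  nonempty words in the letters \<open>1, \<dots>, d\<close>.
\<close>

datatype 'a fmonoid = Word (letters: "'a list")

instantiation fmonoid :: (type) monoid_add
begin

definition zero_fmonoid :: "'a fmonoid"
  where "0 = Word []"

definition plus_fmonoid :: "'a fmonoid \<Rightarrow> 'a fmonoid \<Rightarrow> 'a fmonoid"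
  where "u + v = Word (letters u @ letters v)"

instance
  by standard (simp_all add: zero_fmonoid_def plus_fmonoid_def)

end

definition free_semigroup :: "nat \<Rightarrow> nat fmonoid set"
  where "free_semigroup d = {w. letters w \<noteq> [] \<and> set (letters w) \<subseteq> {1..d}}"

definition free_algebra :: "nat \<Rightarrow> (nat fmonoid \<Rightarrow>\<^sub>0 'k::field) set"
  where "free_algebra d = {p. Poly_Mapping.keys p \<subseteq> free_semigroup d}"

text \<open>
  Ideals of the non-unital algebra are required to be linear subspaces; without a unity,
  closure under scalars does not follow from closure under multiplication.
\<close>

definition is_ideal :: "nat \<Rightarrow> (nat fmonoid \<Rightarrow>\<^sub>0 'k::field) set \<Rightarrow> bool"
  where "is_ideal d I \<longleftrightarrow>
    I \<subseteq> free_algebra d \<and> 0 \<in> I \<and>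
    (\<forall>p\<in>I. \<forall>q\<in>I. p + q \<in> I) \<and>
    (\<forall>c. \<forall>p\<in>I. Poly_Mapping.map ((*) c) p \<in> I) \<and>
    (\<forall>p\<in>I. \<forall>a\<in>free_algebra d. a * p \<in> I \<and> p * a \<in> I)"

definition power_ideal :: "nat \<Rightarrow> nat \<Rightarrow> (nat fmonoid \<Rightarrow>\<^sub>0 'k::field) set"
  where "power_ideal n d = is_ideal d hull {x ^ n | x. x \<in> free_algebra d}"

text \<open>
  The quotient algebra \<open>N\<^bsub>n,d\<^esub>\<close>, with cosets of \<^const>\<open>power_ideal\<close> as elements. Its zero is the
  coset of \<open>0\<close>.
\<close>

definition coset :: "nat \<Rightarrow> nat \<Rightarrow> (nat fmonoid \<Rightarrow>\<^sub>0 'k::field) \<Rightarrow> (nat fmonoid \<Rightarrow>\<^sub>0 'k) set"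
  where "coset n d a = {a + p | p. p \<in> power_ideal n d}"

definition N_carrier :: "nat \<Rightarrow> nat \<Rightarrow> (nat fmonoid \<Rightarrow>\<^sub>0 'k::field) set set"
  where "N_carrier n d = coset n d ` free_algebra d"

definition N_mult :: "nat \<Rightarrow> nat \<Rightarrow> (nat fmonoid \<Rightarrow>\<^sub>0 'k::field) set \<Rightarrow>
    (nat fmonoid \<Rightarrow>\<^sub>0 'k) set \<Rightarrow> (nat fmonoid \<Rightarrow>\<^sub>0 'k) set"
  where "N_mult n d A B = (\<Union>a\<in>A. \<Union>b\<in>B. coset n d (a * b))"

lemma is_ideal_power_ideal:
  assumes "n > 0"
  shows "is_ideal d (power_ideal n d :: (nat fmonoid \<Rightarrow>\<^sub>0 'k::field) set)"
proof -
  let ?A = "free_algebra d :: (nat fmonoid \<Rightarrow>\<^sub>0 'k) set"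
  have mult: "a * b \<in> ?A" if "a \<in> ?A" "b \<in> ?A" for a b
  proof -
    have "u + v \<in> free_semigroup d" if "u \<in> free_semigroup d" "v \<in> free_semigroup d" for u v
      using that by (auto simp: free_semigroup_def plus_fmonoid_def)
    then show ?thesis
      using that keys_mult[of a b] by (force simp: free_algebra_def)
  qed
  have add: "a + b \<in> ?A" if "a \<in> ?A" "b \<in> ?A" for a b
    using that Poly_Mapping.keys_add[of a b] by (auto simp: free_algebra_def)
  have scale: "Poly_Mapping.map ((*) c) a \<in> ?A" if "a \<in> ?A" for c a
    using that by (auto simp: free_algebra_def in_keys_iff Poly_Mapping.map.rep_eq when_def subset_iff)
  have ideal_A: "is_ideal d ?A"
    unfolding is_ideal_def using mult add scale by (simp add: free_algebra_def)
  have pow: "x ^ m \<in> ?A" if "x \<in> ?A" "m > 0" for x m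
    using that(2)
  proof (induction m)
    case (Suc m)
    then show ?case using that(1) mult by (cases m) auto
  qed simp
  have "{x ^ n | x. x \<in> ?A} \<subseteq> ?A"
    using pow assms by blast
  then have "power_ideal n d \<subseteq> ?A"
    unfolding power_ideal_def using ideal_A by (intro hull_minimal)
  moreover have "p \<in> power_ideal n d \<longleftrightarrow>
      (\<forall>J. is_ideal d J \<and> {x ^ n | x. x \<in> ?A} \<subseteq> J \<longrightarrow> p \<in> J)" for p
    by (auto simp: power_ideal_def hull_def)
  ultimately show ?thesis
    by (simp add: is_ideal_def)
qed

lemma N_mult_coset:
  fixes a b :: "nat fmonoid \<Rightarrow>\<^sub>0 'k::field"
  assumes "n > 0" "a \<in> free_algebra d" "b \<in> free_algebra d"
  shows "N_mult n d (coset n d a) (coset n d b) = coset n d (a * b)"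
proof -
  let ?I = "power_ideal n d :: (nat fmonoid \<Rightarrow>\<^sub>0 'k) set"
  have I: "is_ideal d ?I"
    by (rule is_ideal_power_ideal[OF assms(1)])
  have zero: "0 \<in> ?I" and add: "\<And>p q. p \<in> ?I \<Longrightarrow> q \<in> ?I \<Longrightarrow> p + q \<in> ?I"
    and sub: "?I \<subseteq> free_algebra d"
    and mult: "\<And>p c. p \<in> ?I \<Longrightarrow> c \<in> free_algebra d \<Longrightarrow> c * p \<in> ?I \<and> p * c \<in> ?I"
    using I by (auto simp: is_ideal_def)
  have "coset n d ((a + p) * (b + q)) \<subseteq> coset n d (a * b)" if "p \<in> ?I" "q \<in> ?I" for p q
  proof
    fix x assume "x \<in> coset n d ((a + p) * (b + q))"
    then obtain r where r: "r \<in> ?I" "x = (a + p) * (b + q) + r"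
      by (auto simp: coset_def)
    have "x = a * b + (a * q + p * b + p * q + r)"
      using r(2) by (simp add: algebra_simps)
    moreover have "a * q + p * b + p * q + r \<in> ?I"
      using that r(1) sub assms mult add by (meson subsetD)
    ultimately show "x \<in> coset n d (a * b)"
      by (auto simp: coset_def)
  qed
  then have "N_mult n d (coset n d a) (coset n d b) \<subseteq> coset n d (a * b)"
    unfolding N_mult_def coset_def[of n d a] coset_def[of n d b] by blast
  moreover have "coset n d (a * b) \<subseteq> N_mult n d (coset n d a) (coset n d b)"
  proof -
    have "a \<in> coset n d a" "b \<in> coset n d b"
      using zero by (force simp: coset_def)+
    then show ?thesis
      by (auto simp: N_mult_def)
  qed
  ultimately show ?thesis
    by (rule subset_antisym)
qed

text \<open>
  In a list of length \<open>c > 0\<close> the product is \<open>(\<dots>(a\<^sub>1 a\<^sub>2)\<dots>) a\<^sub>c\<close>; there is no unity to start from.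
  The first argument only selects the field.
\<close>

definition nilpotency_degree :: "'k::field itself \<Rightarrow> nat \<Rightarrow> nat \<Rightarrow> nat"
  where "nilpotency_degree TYPE('k) n d =
    (LEAST c. c > 0 \<and>
      (\<forall>as. length as = c \<and> set as \<subseteq> (N_carrier n d :: (nat fmonoid \<Rightarrow>\<^sub>0 'k) set set) \<longrightarrow>
        foldl (N_mult n d) (hd as) (tl as) = coset n d 0))"

end

theory Submission
  imports Defs "HOL-Combinatorics.Multiset_Permutations" "HOL-Computational_Algebra.Primes"
begin

text \<open>
  Put \<open>q = #F = n - 1\<close>, and for a multiset \<open>M\<close> of \<open>n\<close> words let \<open>T(M)\<close> be the sum of the products of
  all arrangements of \<open>M\<close>. Expanding \<open>x\<^sup>n\<close> shows that the ideal of \<open>n\<close>-th powers lies in the ideal \<open>J\<close>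
  generated by all \<open>T(M)\<close>. Over an infinite field the two ideals agree, and whether a word lies in
  \<open>J\<close> depends only on the prime field, since an additive map between the fields that sends 1 to 1
  can be applied to the coefficients. This gives the first inequality.

  Over \<open>F\<close>, divided differences still extract \<open>T(M)\<close> from \<open>n\<close>-th powers when all multiplicities in
  \<open>M\<close> are less than \<open>q\<close>, so only \<open>P(a, b) = T(a\<^sup>q b)\<close> can survive modulo the ideal \<open>I\<close> of \<open>n\<close>-th powers,
  and \<open>P(a, b) + P(b, a)\<close> is in \<open>I\<close>. The identities available in \<open>I\<close> make \<open>P(a, -)\<close> a
  bimodule map modulo \<open>I\<close>; with antisymmetry this yields \<open>P(a, b) x = P(a x, b)\<close> and \<open>J J = 0\<close>
  modulo \<open>I\<close>. If all words of length \<open>c\<close> are in \<open>J\<close>, then the first relation rewrites a word of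
  length greater than \<open>c\<close> as a combination of strictly longer words, because the degree of \<open>P(a x, b)\<close>
  in \<open>x\<close> is \<open>q \<ge> 2\<close>, and words of length at least \<open>2 c\<close> vanish by the second one.
\<close>

section \<open>Identities modulo an ideal containing the powers\<close>

text \<open>
  \<open>lin1 a b k\<close> is the part of \<open>(a + b) ^ (k + 1)\<close> linear in \<open>b\<close>, and \<open>lin2 a b x k\<close> the part of
  \<open>(a + b + x) ^ (k + 2)\<close> linear in both \<open>b\<close> and \<open>x\<close>.
\<close>

primrec lin1 :: "'r::ring_1 \<Rightarrow> 'r \<Rightarrow> nat \<Rightarrow> 'r" where
  "lin1 a b 0 = b"
| "lin1 a b (Suc k) = a * lin1 a b k + b * a ^ Suc k"

primrec lin2 :: "'r::ring_1 \<Rightarrow> 'r \<Rightarrow> 'r \<Rightarrow> nat \<Rightarrow> 'r" where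
  "lin2 a b x 0 = b * x + x * b"
| "lin2 a b x (Suc k) = a * lin2 a b x k + b * lin1 a x (Suc k) + x * lin1 a b (Suc k)"

lemma lin1_eq_sum: "lin1 a b k = (\<Sum>i\<le>k. a ^ i * b * a ^ (k - i))"
  by (induction k) (simp_all add: sum.atMost_Suc_shift sum_distrib_left mult.assoc del: sum.atMost_Suc)

lemma lin1_self: "lin1 a a k = of_nat (Suc k) * a ^ Suc k"
  by (induction k) (simp_all add: algebra_simps mult_of_nat_commute)

lemma lin1_left: "lin1 a (a * x) k = a * lin1 a x k"
  by (induction k) (simp_all add: algebra_simps)

lemma lin1_right: "lin1 a (x * a) k = lin1 a x k * a"
  by (induction k) (simp_all add: algebra_simps power_commutes)

lemma lin1_Suc_right: "lin1 a b (Suc k) = lin1 a b k * a + a ^ Suc k * b"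
proof (induction k)
  case (Suc k)
  show ?case
    by (subst lin1.simps(2), subst Suc) (simp add: algebra_simps power_commutes)
qed simp

text \<open>The defining recursion strips the first letter of each word; this one strips the last,
  for use in right-handed identities.\<close>

lemma lin2_Suc_right:
  "lin2 a b x (Suc k) = lin2 a b x k * a + lin1 a x (Suc k) * b + lin1 a b (Suc k) * x"
proof (induction k)
  case (Suc k)
  show ?case
    apply (subst lin2.simps(2))
    apply (subst Suc)
    apply (subst lin1_Suc_right[of a x "Suc k"], subst lin1_Suc_right[of a b "Suc k"])
    by (simp add: algebra_simps power_commutes)
qed (simp add: algebra_simps)

text \<open>Two splittings of \<open>lin2 a x b (Suc k)\<close> are compared: by the first letter of
  a word, and by the letter directly before \<open>x\<close>. The words starting with
  \<open>x\<close> occur in both and cancel.\<close>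

lemma lin1_mult_left:
  "lin1 a (b * x) (Suc k) = b * lin1 a x (Suc k) + a * lin2 a x b k - lin2 a (a * x) b k"
proof (induction k)
  case (Suc k)
  show ?case
    unfolding lin2.simps(2) lin1_left lin1.simps(2)[of _ _ "Suc k"] Suc
    by (simp add: algebra_simps del: lin1.simps)
qed (simp add: algebra_simps)

text \<open>The mirror image: the last letter is compared with the letter directly after
  \<open>x\<close>.\<close>

lemma lin1_mult_right:
  "lin1 a (x * b) (Suc k) = lin1 a x (Suc k) * b + lin2 a x b k * a - lin2 a (x * a) b k"
proof (induction k)
  case (Suc k)
  show ?case
    unfolding lin2_Suc_right lin1_right lin1_Suc_right[of _ _ "Suc k"] Suc
    by (simp add: algebra_simps del: lin1.simps)
qed (simp add: algebra_simps)

text \<open>Abstracts the ideal of powers over a field with \<open>q\<close> elements. There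
  \<open>t ^ q = t\<close>, so scaling \<open>a\<close> and \<open>b\<close> cannot separate the two
  summands of \<open>I_swap\<close>, while multiplicities below \<open>q\<close>, as in
  \<open>I_lin2\<close>, can be isolated.\<close>

locale nil_ideal =
  fixes A I :: "'r::ring_1 set" and q :: nat
  assumes q: "q \<ge> 2"
    and A_mult: "a \<in> A \<Longrightarrow> b \<in> A \<Longrightarrow> a * b \<in> A"
    and I_zero: "0 \<in> I"
    and I_add: "x \<in> I \<Longrightarrow> y \<in> I \<Longrightarrow> x + y \<in> I"
    and I_uminus: "x \<in> I \<Longrightarrow> - x \<in> I"
    and I_mult_left: "a \<in> A \<Longrightarrow> x \<in> I \<Longrightarrow> a * x \<in> I"
    and I_mult_right: "a \<in> A \<Longrightarrow> x \<in> I \<Longrightarrow> x * a \<in> I"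
    and I_power: "a \<in> A \<Longrightarrow> a ^ Suc q \<in> I"
    and I_lin2: "a \<in> A \<Longrightarrow> b \<in> A \<Longrightarrow> x \<in> A \<Longrightarrow> lin2 a b x (q - 1) \<in> I"
    and I_swap: "a \<in> A \<Longrightarrow> b \<in> A \<Longrightarrow> lin1 a b q + lin1 b a q \<in> I"
begin

abbreviation P :: "'r \<Rightarrow> 'r \<Rightarrow> 'r" where "P a b \<equiv> lin1 a b q"

definition cong :: "'r \<Rightarrow> 'r \<Rightarrow> bool" (infix "\<approx>" 50)
  where "x \<approx> y \<longleftrightarrow> x - y \<in> I"

lemma I_diff: "x \<in> I \<Longrightarrow> y \<in> I \<Longrightarrow> x - y \<in> I"
  using I_add[of x "- y"] I_uminus[of y] by simp

lemma I_sum: "(\<And>i. i \<in> S \<Longrightarrow> f i \<in> I) \<Longrightarrow> sum f S \<in> I"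
  by (induction S rule: infinite_finite_induct) (auto simp: I_zero I_add)

lemma A_power: "a \<in> A \<Longrightarrow> a ^ Suc k \<in> A"
  by (induction k) (auto simp: A_mult)

lemma cong_refl [simp]: "x \<approx> x"
  by (simp add: cong_def I_zero)

lemma cong_sym: "x \<approx> y \<Longrightarrow> y \<approx> x"
  using I_uminus[of "x - y"] by (simp add: cong_def)

lemma cong_trans [trans]: "x \<approx> y \<Longrightarrow> y \<approx> z \<Longrightarrow> x \<approx> z"
  using I_add[of "x - y" "y - z"] by (simp add: cong_def)

lemma cong_uminus: "x \<approx> y \<Longrightarrow> - x \<approx> - y"
  using I_uminus[of "x - y"] by (simp add: cong_def)

lemma cong_mult_left: "x \<approx> y \<Longrightarrow> a \<in> A \<Longrightarrow> a * x \<approx> a * y"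
  using I_mult_left[of a "x - y"] by (simp add: cong_def right_diff_distrib)

lemma cong_mult_right: "x \<approx> y \<Longrightarrow> a \<in> A \<Longrightarrow> x * a \<approx> y * a"
  using I_mult_right[of a "x - y"] by (simp add: cong_def left_diff_distrib)

lemma cong_I: "x \<approx> y \<Longrightarrow> y \<in> I \<Longrightarrow> x \<in> I"
  using I_add[of "x - y" y] by (simp add: cong_def)

section \<open>Bimodule and annihilation properties of \<open>P\<close>\<close>

lemma P_anti: "a \<in> A \<Longrightarrow> b \<in> A \<Longrightarrow> P a b \<approx> - P b a"
  using I_swap[of a b] by (simp add: cong_def)

lemma P_left:
  assumes "a \<in> A" "b \<in> A" "x \<in> A"
  shows "P a (b * x) \<approx> b * P a x"
proof -
  have "P a (b * x) - b * P a x = a * lin2 a x b (q - 1) - lin2 a (a * x) b (q - 1)"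
    using lin1_mult_left[of a b x "q - 1"] q by simp
  then show ?thesis
    by (simp only: cong_def) (intro I_diff I_mult_left I_lin2 A_mult assms)
qed

lemma P_right:
  assumes "a \<in> A" "b \<in> A" "x \<in> A"
  shows "P a (x * b) \<approx> P a x * b"
proof -
  have "P a (x * b) - P a x * b = lin2 a x b (q - 1) * a - lin2 a (x * a) b (q - 1)"
    using lin1_mult_right[of a x b "q - 1"] q by simp
  then show ?thesis
    by (simp only: cong_def) (intro I_diff I_mult_right I_lin2 A_mult assms)
qed

text \<open>Antisymmetry moves \<open>a\<close> into the linear argument, which absorbs
  \<open>x\<close>, and then moves \<open>a * x\<close> back. Thus \<open>x\<close> ends up in the
  argument of degree \<open>q\<close>.\<close>

lemma P_mult_arg:
  assumes "a \<in> A" "b \<in> A" "x \<in> A"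
  shows "P a b * x \<approx> P (a * x) b"
proof -
  have "P a b * x \<approx> - P b a * x"
    by (intro cong_mult_right P_anti assms)
  also have "- P b a * x \<approx> - P b (a * x)"
    using cong_uminus[OF cong_sym[OF P_right[of b x a]]] assms by simp
  also have "- P b (a * x) \<approx> P (a * x) b"
    by (intro cong_sym[OF P_anti] A_mult assms)
  finally show ?thesis .
qed

text \<open>One factor is absorbed into \<open>b\<close> and the other into \<open>a\<close>; the
  two absorptions do not interfere, so their order is immaterial.\<close>

lemma P_mult_commute:
  assumes "a \<in> A" "b \<in> A" "x \<in> A" "y \<in> A"
  shows "P a b * (x * y) \<approx> P a b * (y * x)"
proof -
  have "P a b * x * y \<approx> P a (b * x) * y"
    by (intro cong_mult_right cong_sym[OF P_right] assms)
  also have "\<dots> \<approx> P (a * y) (b * x)"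
    by (intro P_mult_arg assms A_mult)
  also have "\<dots> \<approx> P (a * y) b * x"
    by (intro P_right assms A_mult)
  also have "\<dots> \<approx> P a b * y * x"
    by (intro cong_mult_right cong_sym[OF P_mult_arg] assms)
  finally show ?thesis
    by (simp add: mult.assoc)
qed

lemma P_self: "a \<in> A \<Longrightarrow> P a a \<in> I"
proof -
  assume a: "a \<in> A"
  have "of_nat k * a ^ Suc q \<in> I" for k
    by (induction k) (simp_all add: I_zero I_add I_power[OF a, simplified] algebra_simps)
  then show ?thesis
    by (simp only: lin1_self)
qed

text \<open>The first \<open>c\<close> replaces \<open>b\<close> in the linear argument, while
  \<open>b\<close> moves out to the left. The second turns \<open>P a c\<close> into a multiple of
  \<open>P c c\<close>, which is in \<open>I\<close>.\<close>

lemma P_mult_square: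
  assumes "a \<in> A" "b \<in> A" "c \<in> A"
  shows "P a b * (c * c) \<in> I"
proof -
  have *: "P a b * c \<approx> b * P a c"
    by (rule cong_trans[OF cong_sym[OF P_right] P_left]) (use assms in auto)
  have "P a c * c \<approx> - P c a * c"
    by (intro cong_mult_right P_anti assms)
  also have "\<dots> \<approx> - P c (a * c)"
    using cong_uminus[OF cong_sym[OF P_right[of c c a]]] assms by simp
  also have "\<dots> \<approx> - (a * P c c)"
    by (intro cong_uminus P_left assms)
  finally have "P a c * c \<in> I"
    by (rule cong_I) (use assms P_self I_uminus I_mult_left in auto)
  then have "b * (P a c * c) \<in> I"
    using assms I_mult_left by blast
  moreover have "P a b * c * c \<approx> b * P a c * c"
    by (intro cong_mult_right * assms)
  ultimately show ?thesis
    using cong_I by (simp add: mult.assoc)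
qed

text \<open>To the right of \<open>P a b\<close>, each summand
  \<open>c ^ i * d * c ^ (q - i)\<close> of \<open>P c d\<close> can be rearranged to
  \<open>c ^ q * d\<close>, and \<open>q \<ge> 2\<close> supplies a square.\<close>

lemma P_mult_P:
  assumes "a \<in> A" "b \<in> A" "c \<in> A" "d \<in> A"
  shows "P a b * P c d \<in> I"
proof -
  obtain r where r: "q = Suc (Suc r)"
    using q by (metis One_nat_def Suc_1 add_2_eq_Suc le_Suc_ex)
  have sq: "P a b * c ^ Suc (Suc k) \<in> I" for k
  proof (cases k)
    case (Suc j)
    then show ?thesis
      using I_mult_right[OF A_power[of c j] P_mult_square[of a b c]] assms by (simp add: mult.assoc)
  qed (use P_mult_square assms in auto)
  have sqd: "P a b * (c ^ q * d) \<in> I"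
    using I_mult_right[OF assms(4) sq[of r]] by (simp only: r mult.assoc)
  have "P a b * (c ^ i * d * c ^ (q - i)) \<in> I" if "i \<le> q" for i
  proof -
    consider "i = 0" | "i = q" | "i > 0" "i < q"
      using \<open>i \<le> q\<close> by linarith
    then show ?thesis
    proof cases
      case 1
      then show ?thesis
        using cong_I[OF P_mult_commute[of a b d "c ^ q"] sqd] assms A_power[of c "Suc r"] r by auto
    next
      case 3
      then obtain j k where jk: "i = Suc j" "q - i = Suc k"
        by (metis gr0_conv_Suc zero_less_diff)
      then have "c ^ q = c ^ Suc j * c ^ Suc k"
        using that by (metis le_add_diff_inverse power_add)
      \<comment> \<open>Moving \<open>c ^ i\<close> to the end reduces the mixed case to
        \<open>d * c ^ q\<close>, the summand for \<open>i = 0\<close>.\<close>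
      moreover have "P a b * (c ^ Suc j * (d * c ^ Suc k)) \<approx> P a b * ((d * c ^ Suc k) * c ^ Suc j)"
        using assms by (intro P_mult_commute A_mult A_power)
      moreover have "P a b * (d * c ^ q) \<in> I"
        using cong_I[OF P_mult_commute[of a b d "c ^ q"] sqd] assms A_power[of c "Suc r"] r by auto
      ultimately show ?thesis
        using cong_I jk by (metis mult.assoc power_commuting_commutes)
    qed (use sqd in simp)
  qed
  then show ?thesis
    by (auto simp: lin1_eq_sum[of c] sum_distrib_left intro!: I_sum)
qed

end

section \<open>Symmetrized products\<close>

text \<open>The multiset holds indices, so letters at different indices stay distinct even if their
  values agree. Each arrangement counts once; no factorials appear that could vanish in positive
  characteristic.\<close>

definition symsum :: "('i \<Rightarrow> 'r::ring_1) \<Rightarrow> 'i multiset \<Rightarrow> 'r"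
  where "symsum y M = (\<Sum>xs\<in>permutations_of_multiset M. prod_list (map y xs))"

lemma symsum_empty [simp]: "symsum y {#} = 1"
  by (simp add: symsum_def)

lemma symsum_rec:
  assumes "M \<noteq> {#}"
  shows "symsum y M = (\<Sum>i\<in>set_mset M. y i * symsum y (M - {#i#}))"
proof -
  have "symsum y M =
      (\<Sum>i\<in>set_mset M. \<Sum>xs\<in>(#) i ` permutations_of_multiset (M - {#i#}). prod_list (map y xs))"
    unfolding symsum_def permutations_of_multiset_nonempty[OF assms]
    by (rule sum.UNION_disjoint) auto
  also have "\<dots> = (\<Sum>i\<in>set_mset M. y i * symsum y (M - {#i#}))"
    by (intro sum.cong refl) (simp add: sum.reindex symsum_def sum_distrib_left)
  finally show ?thesis .
qed

lemma symsum_replicate: "symsum y (replicate_mset k i) = y i ^ k"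
  by (induction k) (simp_all add: symsum_rec)

lemma symsum_lin1:
  assumes "i \<noteq> j"
  shows "symsum y (add_mset j (replicate_mset k i)) = lin1 (y i) (y j) k"
proof (induction k)
  case 0
  then show ?case by (simp add: symsum_rec)
next
  case (Suc k)
  have "set_mset (add_mset j (replicate_mset (Suc k) i)) = {i, j}"
    by auto
  moreover have "add_mset j (replicate_mset (Suc k) i) - {#i#} = add_mset j (replicate_mset k i)"
    using assms by simp
  moreover have "add_mset j (replicate_mset (Suc k) i) - {#j#} = replicate_mset (Suc k) i"
    by simp
  ultimately show ?case
    using assms Suc by (subst symsum_rec) (simp_all add: symsum_replicate del: replicate_mset_Suc)
qed

lemma symsum_lin2:
  assumes "i \<noteq> j" "i \<noteq> l" "j \<noteq> l"
  shows "symsum y (add_mset j (add_mset l (replicate_mset k i))) = lin2 (y i) (y j) (y l) k"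
proof (induction k)
  case 0
  show ?case using assms by (simp add: symsum_rec)
next
  case (Suc k)
  let ?M = "add_mset j (add_mset l (replicate_mset (Suc k) i))"
  have "set_mset ?M = {i, j, l}"
    by auto
  moreover have "?M - {#i#} = add_mset j (add_mset l (replicate_mset k i))"
    using assms by simp
  moreover have "?M - {#j#} = add_mset l (replicate_mset (Suc k) i)"
    by simp
  moreover have "?M - {#l#} = add_mset j (replicate_mset (Suc k) i)"
    using assms by simp
  ultimately show ?case
    using assms Suc
    by (subst symsum_rec)
      (simp_all add: symsum_lin1 add.assoc del: replicate_mset_Suc lin1.simps)
qed

section \<open>Powers of sums and extraction of their multihomogeneous components\<close>

lemma finite_msets_of_size:
  "finite Y \<Longrightarrow> finite {M. size M = n \<and> set_mset M \<subseteq> Y}"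
proof -
  assume "finite Y"
  have "{M. size M = n \<and> set_mset M \<subseteq> Y} \<subseteq> mset ` {xs. set xs \<subseteq> Y \<and> length xs = n}"
  proof
    fix M assume "M \<in> {M. size M = n \<and> set_mset M \<subseteq> Y}"
    moreover obtain xs where "mset xs = M"
      using ex_mset by blast
    ultimately show "M \<in> mset ` {xs. set xs \<subseteq> Y \<and> length xs = n}"
      by (auto intro!: image_eqI[of _ _ xs])
  qed
  then show ?thesis
    using finite_lists_length_eq[OF \<open>finite Y\<close>] finite_surj by blast
qed

text \<open>The noncommutative multinomial expansion, with words grouped by content.\<close>

lemma power_sum_eq_symsum:
  assumes Y: "finite Y"
  shows "(\<Sum>i\<in>Y. y i) ^ n = (\<Sum>M | size M = n \<and> set_mset M \<subseteq> Y. symsum y M)"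
proof (induction n)
  case 0
  have "{M. size M = 0 \<and> set_mset M \<subseteq> Y} = {{#}}"
    by auto
  then show ?case by simp
next
  case (Suc n)
  let ?S = "\<lambda>n. {M. size M = n \<and> set_mset M \<subseteq> Y}"
  have "(\<Sum>M\<in>?S (Suc n). symsum y M) =
      (\<Sum>M\<in>?S (Suc n). \<Sum>i\<in>set_mset M. y i * symsum y (M - {#i#}))"
    by (intro sum.cong refl symsum_rec) auto
  also have "\<dots> = (\<Sum>(M, i)\<in>Sigma (?S (Suc n)) set_mset. y i * symsum y (M - {#i#}))"
    by (rule sum.Sigma) (auto intro: finite_msets_of_size[OF Y, of "Suc n", simplified])
  also have "\<dots> = (\<Sum>(i, M)\<in>Y \<times> ?S n. y i * symsum y M)"
    by (rule sum.reindex_bij_witness[of _ "\<lambda>(i, M). (add_mset i M, i)" "\<lambda>(M, i). (i, M - {#i#})"])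
      (auto simp: size_Diff_singleton dest: in_diffD)
  also have "\<dots> = (\<Sum>i\<in>Y. y i) * (\<Sum>M\<in>?S n. symsum y M)"
    by (simp add: sum_product sum.cartesian_product)
  finally show ?case
    by (simp add: Suc)
qed

text \<open>The weights are those of the divided difference of order \<open>c\<close> at the points of \<open>S\<close>.\<close>

lemma exists_power_weights:
  fixes S :: "'k::field set"
  assumes "finite S" "card S = Suc c"
  shows "\<exists>W. (\<forall>k<c. (\<Sum>t\<in>S. W t * t ^ k) = 0) \<and> (\<Sum>t\<in>S. W t * t ^ c) = 1"
  using assms
proof (induction c arbitrary: S)
  case 0
  then obtain s where "S = {s}"
    by (auto simp: card_1_singleton_iff)
  then show ?case
    by (intro exI[of _ "\<lambda>_. 1"]) auto
next
  case (Suc c)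
  then obtain s S' where S: "S = insert s S'" "s \<notin> S'" "card S' = Suc c" "finite S'"
    by (metis card_Suc_eq finite_insert)
  obtain W where W0: "\<And>k. k < c \<Longrightarrow> (\<Sum>t\<in>S'. W t * t ^ k) = 0" and W1: "(\<Sum>t\<in>S'. W t * t ^ c) = 1"
    using Suc.IH[OF S(4,3)] by blast
  \<comment> \<open>Applies \<open>W\<close> to the difference quotient
    \<open>(f t - f s) / (t - s)\<close>; the weight at the new point \<open>s\<close> collects the
    terms with \<open>f s\<close>.\<close>
  define W' where "W' t = (if t = s then - (\<Sum>t\<in>S'. W t / (t - s)) else W t / (t - s))" for t
  \<comment> \<open>The difference quotient of \<open>t ^ k\<close> has degree \<open>k - 1\<close>
    and leading coefficient 1 for \<open>k > 0\<close>, so the order goes up by one.\<close>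
  have *: "(\<Sum>t\<in>S. W' t * t ^ k) = (\<Sum>i<k. s ^ (k - Suc i) * (\<Sum>t\<in>S'. W t * t ^ i))" for k
  proof -
    have "(\<Sum>t\<in>S. W' t * t ^ k) = (\<Sum>t\<in>S'. W t / (t - s) * t ^ k) - (\<Sum>t\<in>S'. W t / (t - s)) * s ^ k"
      using S by (simp add: W'_def) (intro sum.cong refl, auto)
    also have "\<dots> = (\<Sum>t\<in>S'. W t / (t - s) * (t ^ k - s ^ k))"
      by (simp add: sum_distrib_right sum_subtractf right_diff_distrib)
    also have "\<dots> = (\<Sum>t\<in>S'. \<Sum>i<k. s ^ (k - Suc i) * (W t * t ^ i))"
    proof (intro sum.cong refl)
      fix t assume "t \<in> S'"
      then have "t - s \<noteq> 0"
        using S by auto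
      then show "W t / (t - s) * (t ^ k - s ^ k) = (\<Sum>i<k. s ^ (k - Suc i) * (W t * t ^ i))"
        by (simp add: power_diff_sumr2 sum_distrib_left mult_ac)
    qed
    also have "\<dots> = (\<Sum>i<k. s ^ (k - Suc i) * (\<Sum>t\<in>S'. W t * t ^ i))"
      by (subst sum.swap) (simp add: sum_distrib_left)
    finally show ?thesis .
  qed
  have "(\<Sum>t\<in>S. W' t * t ^ k) = 0" if "k < Suc c" for k
    unfolding * by (intro sum.neutral) (use that W0 in auto)
  moreover have "(\<Sum>t\<in>S. W' t * t ^ Suc c) = 1"
    unfolding * by (simp add: W0 W1)
  ultimately show ?case
    by blast
qed

lemma single_sum: "Poly_Mapping.single u (sum f S) = (\<Sum>x\<in>S. Poly_Mapping.single u (f x))"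
  by (induction S rule: infinite_finite_induct) (simp_all add: single_add)

text \<open>Scalars are multiples of the empty word, so scaling becomes a ring
  multiplication.\<close>

lemma single_zero_central:
  fixes p :: "'m::monoid_add \<Rightarrow>\<^sub>0 'k::field"
  shows "Poly_Mapping.single 0 c * p = p * Poly_Mapping.single 0 c"
proof (induction p rule: update_induct)
  case (update p a b)
  have "Poly_Mapping.update a b p = p + Poly_Mapping.single a b"
    using update by (intro poly_mapping_eqI)
      (auto simp: lookup_update lookup_add lookup_single when_def in_keys_iff)
  then show ?case
    by (simp add: update distrib_left distrib_right mult_single mult.commute)
qed simp

lemma prod_list_scale:
  fixes y :: "'i \<Rightarrow> 'm::monoid_add \<Rightarrow>\<^sub>0 'k::field"
  shows "prod_list (map (\<lambda>i. Poly_Mapping.single 0 (a i) * y i) xs) =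
    Poly_Mapping.single 0 (prod_list (map a xs)) * prod_list (map y xs)"
proof (induction xs)
  case (Cons i xs)
  have "y i * (Poly_Mapping.single 0 c * p) = Poly_Mapping.single 0 c * (y i * p)" for c p
    by (metis mult.assoc single_zero_central)
  then show ?case
    by (simp add: Cons mult.assoc) (simp add: mult_single flip: mult.assoc)
qed simp

lemma symsum_scale:
  fixes y :: "'i \<Rightarrow> 'm::monoid_add \<Rightarrow>\<^sub>0 'k::field"
  assumes "finite Y" "set_mset M \<subseteq> Y"
  shows "symsum (\<lambda>i. Poly_Mapping.single 0 (a i) * y i) M =
    Poly_Mapping.single 0 (\<Prod>i\<in>Y. a i ^ count M i) * symsum y M"
proof -
  have "prod_list (map a xs) = (\<Prod>i\<in>Y. a i ^ count M i)" if "xs \<in> permutations_of_multiset M" for xs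
  proof -
    have "prod_list (map a xs) = prod_mset (image_mset a M)"
      using permutations_of_multisetD[OF that] by (metis mset_map prod_mset_prod_list)
    also have "\<dots> = (\<Prod>i\<in>set_mset M. a i ^ count M i)"
      by (rule image_prod_mset_multiplicity)
    also have "\<dots> = (\<Prod>i\<in>Y. a i ^ count M i)"
      by (intro prod.mono_neutral_left assms) (auto simp: not_in_iff)
    finally show ?thesis .
  qed
  then show ?thesis
    unfolding symsum_def prod_list_scale by (simp add: sum_distrib_left)
qed

text \<open>Scaling each \<open>y i\<close> by a parameter makes the power a polynomial in the
  parameters, in which \<open>symsum y M\<close> is the coefficient with exponents
  \<open>count M\<close>. Divided differences of order \<open>count M i\<close> in each parameter
  isolate it; they require \<open>count M i + 1\<close> points of the field.\<close>

lemma symsum_in_subspace: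
  fixes y :: "'i \<Rightarrow> 'm::monoid_add \<Rightarrow>\<^sub>0 'k::field"
  assumes zero: "0 \<in> V" and add: "\<And>v w. v \<in> V \<Longrightarrow> w \<in> V \<Longrightarrow> v + w \<in> V"
    and scale: "\<And>c v. v \<in> V \<Longrightarrow> Poly_Mapping.single 0 c * v \<in> V"
    and power: "\<And>a. (\<Sum>i\<in>set_mset M. Poly_Mapping.single 0 (a i) * y i) ^ size M \<in> V"
    and count: "\<And>i. \<exists>S::'k set. finite S \<and> card S = Suc (count M i)"
  shows "symsum y M \<in> V"
proof -
  define Y where "Y = set_mset M"
  have Y: "finite Y"
    by (simp add: Y_def)
  define N where "N = {M'. size M' = size M \<and> set_mset M' \<subseteq> Y}"
  have N: "finite N"
    unfolding N_def by (rule finite_msets_of_size[OF Y])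
  obtain S :: "'i \<Rightarrow> 'k set" where S: "\<And>i. finite (S i)" "\<And>i. card (S i) = Suc (count M i)"
    using count by metis
  obtain W where W0: "\<And>i k. k < count M i \<Longrightarrow> (\<Sum>t\<in>S i. W i t * t ^ k) = 0"
    and W1: "\<And>i. (\<Sum>t\<in>S i. W i t * t ^ count M i) = 1"
    using exists_power_weights[OF S] by metis
  have "(\<Sum>a\<in>PiE Y S. Poly_Mapping.single 0 (\<Prod>i\<in>Y. W i (a i)) *
      (\<Sum>i\<in>Y. Poly_Mapping.single 0 (a i) * y i) ^ size M) =
    (\<Sum>a\<in>PiE Y S. \<Sum>M'\<in>N. Poly_Mapping.single 0 (\<Prod>i\<in>Y. W i (a i) * a i ^ count M' i) * symsum y M')"
    unfolding power_sum_eq_symsum[OF Y] sum_distrib_left N_def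
    by (intro sum.cong refl)
      (simp add: symsum_scale[OF Y] mult_single prod.distrib flip: mult.assoc)
  also have "\<dots> = (\<Sum>M'\<in>N. Poly_Mapping.single 0 (\<Prod>i\<in>Y. \<Sum>t\<in>S i. W i t * t ^ count M' i) * symsum y M')"
    by (subst sum.swap) (simp add: prod_sum_PiE Y S single_sum sum_distrib_right)
  also have "\<dots> = (\<Sum>M'\<in>N. if M' = M then symsum y M' else 0)"
  proof (intro sum.cong refl)
    fix M' assume M': "M' \<in> N"
    show "Poly_Mapping.single 0 (\<Prod>i\<in>Y. \<Sum>t\<in>S i. W i t * t ^ count M' i) * symsum y M' =
        (if M' = M then symsum y M' else 0)"
    proof (cases "M' = M")
      case False
      \<comment> \<open>Since \<open>M\<close> and \<open>M'\<close> have equal size,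
        \<open>M'\<close> falls short of \<open>M\<close> at some letter, and the divided difference
        in that parameter annihilates it.\<close>
      have "\<not> M \<subseteq># M'"
        using M' False mset_subset_size[of M M'] by (auto simp: N_def subset_mset.less_le)
      then obtain i where i: "count M' i < count M i"
        by (auto simp: subseteq_mset_def not_le)
      then have "i \<in> Y"
        by (auto simp: Y_def simp flip: count_greater_zero_iff)
      then have "(\<Prod>i\<in>Y. \<Sum>t\<in>S i. W i t * t ^ count M' i) = 0"
        using W0[OF i] Y by (auto intro: prod_zero)
      then show ?thesis
        using False by simp
    qed (simp add: W1)
  qed
  also have "\<dots> = symsum y M"
    using N by (simp add: N_def Y_def)
  finally have "symsum y M = (\<Sum>a\<in>PiE Y S. Poly_Mapping.single 0 (\<Prod>i\<in>Y. W i (a i)) *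
      (\<Sum>i\<in>Y. Poly_Mapping.single 0 (a i) * y i) ^ size M)" ..
  moreover have "sum f T \<in> V" if "\<And>x. x \<in> T \<Longrightarrow> f x \<in> V" for f :: "('i \<Rightarrow> 'k) \<Rightarrow> _" and T
    using that by (induction T rule: infinite_finite_induct) (auto intro: zero add)
  ultimately show ?thesis
    using scale power by (simp add: Y_def)
qed

section \<open>Additive maps between fields of equal characteristic\<close>

text \<open>A ring homomorphism need not exist. Instead, a maximal additive subgroup
  \<open>M\<close> without 1 is divided out; the quotient is the prime field, which embeds into
  \<open>'b\<close>.\<close>

lemma exists_additive_map:
  assumes "CHAR('a::field) = CHAR('b::field)" "CHAR('a) > 0"
  shows "\<exists>\<phi>::'a \<Rightarrow> 'b. (\<forall>x y. \<phi> (x + y) = \<phi> x + \<phi> y) \<and> \<phi> 1 = 1"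
proof -
  define p where "p = int CHAR('a)"
  have p: "prime p"
    using assms(2) by (simp add: p_def prime_CHAR_semidom)
  have of_int_a: "(of_int k :: 'a) = 0 \<longleftrightarrow> p dvd k" for k
    by (simp add: p_def of_int_eq_0_iff_char_dvd)
  have of_int_b: "(of_int k :: 'b) = 0 \<longleftrightarrow> p dvd k" for k
    by (simp add: p_def of_int_eq_0_iff_char_dvd assms(1))
  have inv: "\<exists>j'. of_int j' * of_int j = (1::'a)" if "\<not> p dvd j" for j
  proof -
    have "gcd j p = 1"
      using prime_imp_coprime[OF p that] by (simp add: coprime_iff_gcd_eq_1 gcd.commute)
    then obtain u v where "u * j + v * p = 1"
      using bezout_int[of j p] by auto
    then have "of_int u * of_int j + of_int v * of_int p = (1::'a)"
      by (metis of_int_1 of_int_add of_int_mult)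
    then show ?thesis
      using of_int_a[of p] by auto
  qed
  define \<A> where "\<A> = {H :: 'a set. 0 \<in> H \<and> (\<forall>x\<in>H. \<forall>y\<in>H. x - y \<in> H) \<and> 1 \<notin> H}"
  have "\<exists>M\<in>\<A>. \<forall>X\<in>\<A>. M \<subseteq> X \<longrightarrow> X = M"
  proof (rule subset_Zorn_nonempty)
    show "\<A> \<noteq> {}"
      by (auto simp: \<A>_def intro!: exI[of _ "{0}"])
    fix C assume C: "C \<noteq> {}" "subset.chain \<A> C"
    have "x - y \<in> \<Union>C" if x: "x \<in> \<Union>C" and y: "y \<in> \<Union>C" for x y
    proof -
      from x y obtain X Y where XY: "X \<in> C" "Y \<in> C" "x \<in> X" "y \<in> Y"
        by blast
      then have "X \<subseteq> Y \<or> Y \<subseteq> X"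
        using C(2) unfolding subset.chain_def by blast
      then obtain Z where "Z \<in> C" "x \<in> Z" "y \<in> Z"
        using XY by blast
      then show ?thesis
        using C(2) by (auto simp: subset.chain_def \<A>_def)
    qed
    then show "\<Union>C \<in> \<A>"
      using C by (auto simp: subset.chain_def \<A>_def)
  qed
  then obtain M where M: "M \<in> \<A>" and max: "\<And>X. X \<in> \<A> \<Longrightarrow> M \<subseteq> X \<Longrightarrow> X = M"
    by blast
  have zero: "0 \<in> M" and diff: "\<And>x y. x \<in> M \<Longrightarrow> y \<in> M \<Longrightarrow> x - y \<in> M" and one: "1 \<notin> M"
    using M by (auto simp: \<A>_def)
  have uminus: "- x \<in> M" if "x \<in> M" for x
    using diff[OF zero that] by simp
  have add: "x + y \<in> M" if "x \<in> M" "y \<in> M" for x y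
    using diff[OF that(1) uminus[OF that(2)]] by simp
  have of_nat_mult: "of_nat k * x \<in> M" if "x \<in> M" for k x
    by (induction k) (auto simp: zero algebra_simps intro: add that)
  have mult: "of_int k * x \<in> M" if "x \<in> M" for k x
    using of_nat_mult[OF that] uminus by (cases k rule: int_cases2) auto
  \<comment> \<open>Makes the integer representing a class modulo \<open>M\<close> unique modulo
    \<open>p\<close>.\<close>
  have dvd: "p dvd k" if "of_int k \<in> M" for k
  proof (rule ccontr)
    assume "\<not> p dvd k"
    then show False
      using inv[of k] mult[OF that] one by metis
  qed
  have ex: "\<exists>k. x - of_int k \<in> M" for x
  proof (cases "x \<in> M")
    case False
    \<comment> \<open>By maximality of \<open>M\<close>, the subgroup generated by \<open>M\<close>
      and \<open>x\<close> contains 1. The coefficient of \<open>x\<close> in this representation of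
      1 is invertible modulo \<open>p\<close>, so \<open>x\<close> is an integer modulo
      \<open>M\<close>.\<close>
    define H where "H = {h + of_int j * x | h j. h \<in> M}"
    have "M \<subseteq> H"
      by (force simp: H_def intro: exI[of _ 0])
    moreover have "x \<in> H"
      using zero by (force simp: H_def intro: exI[of _ 0] exI[of _ 1])
    ultimately have "H \<notin> \<A>"
      using max False by blast
    moreover have "u - v \<in> H" if "u \<in> H" "v \<in> H" for u v
    proof -
      from that obtain h j h' j' where "h \<in> M" "h' \<in> M" "u = h + of_int j * x" "v = h' + of_int j' * x"
        by (auto simp: H_def)
      then have "u - v = (h - h') + of_int (j - j') * x" "h - h' \<in> M"
        using diff by (auto simp: algebra_simps)
      then show ?thesis
        unfolding H_def by blast
    qed
    ultimately have "1 \<in> H"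
      using zero \<open>M \<subseteq> H\<close> by (auto simp: \<A>_def)
    then obtain h j where hj: "h \<in> M" "1 = h + of_int j * x"
      by (auto simp: H_def)
    then have "\<not> p dvd j"
      using one of_int_a[of j] by auto
    then obtain j' where j': "of_int j' * of_int j = (1::'a)"
      using inv by blast
    have "of_int j' = of_int j' * h + x"
      using arg_cong[OF hj(2), of "\<lambda>z. of_int j' * z"] j' by (simp add: distrib_left flip: mult.assoc)
    then have "x - of_int j' = - (of_int j' * h)"
      by algebra
    then show ?thesis
      using uminus[OF mult[OF hj(1)]] by metis
  qed (auto intro: exI[of _ 0])
  define k where "k x = (SOME k. x - of_int k \<in> M)" for x
  have k: "x - of_int (k x) \<in> M" for x
    unfolding k_def by (rule someI_ex[OF ex])
  have "of_int (k (x + y)) = (of_int (k x) + of_int (k y) :: 'b)" for x y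
  proof -
    have "of_int (k (x + y) - k x - k y) = (x - of_int (k x)) + (y - of_int (k y)) - (x + y - of_int (k (x + y)))"
      by simp
    then have "of_int (k (x + y) - k x - k y) \<in> M"
      using diff[OF add[OF k k] k] by metis
    from dvd[OF this] have "(of_int (k (x + y) - k x - k y) :: 'b) = 0"
      by (simp only: of_int_b)
    then show ?thesis
      by (simp add: algebra_simps)
  qed
  moreover have "of_int (k 1) = (1::'b)"
  proof -
    have "of_int (1 - k 1) \<in> M"
      using k[of 1] by simp
    from dvd[OF this] have "(of_int (1 - k 1) :: 'b) = 0"
      by (simp only: of_int_b)
    then show ?thesis
      by simp
  qed
  ultimately show ?thesis
    by (intro exI[of _ "\<lambda>x. of_int (k x)"]) auto
qed

section \<open>The span of the symmetrized products\<close>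

abbreviation len :: "nat fmonoid \<Rightarrow> nat"
  where "len w \<equiv> length (letters w)"

abbreviation word :: "nat fmonoid \<Rightarrow> nat fmonoid \<Rightarrow>\<^sub>0 'k::field"
  where "word w \<equiv> Poly_Mapping.single w 1"

lemma letters_zero [simp]: "letters 0 = []"
  and letters_plus [simp]: "letters (u + v) = letters u @ letters v"
  by (simp_all add: zero_fmonoid_def plus_fmonoid_def)

lemma len_sum_list: "len (sum_list ws) = (\<Sum>w\<leftarrow>ws. len w)"
  by (induction ws) auto

text \<open>Contains the empty word, unlike \<open>free_semigroup\<close>, so that outer factors may
  be absent.\<close>

definition words :: "nat \<Rightarrow> nat fmonoid set"
  where "words d = {w. set (letters w) \<subseteq> {1..d}}"

lemma words_zero [simp]: "0 \<in> words d"
  and words_plus [simp]: "u + v \<in> words d \<longleftrightarrow> u \<in> words d \<and> v \<in> words d"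
  by (auto simp: words_def)

lemma free_semigroup_iff: "w \<in> free_semigroup d \<longleftrightarrow> w \<in> words d \<and> len w \<ge> 1"
  by (cases "letters w") (auto simp: free_semigroup_def words_def)

section \<open>Filtration of the free algebra by degree\<close>

definition deg_ge :: "nat \<Rightarrow> nat \<Rightarrow> (nat fmonoid \<Rightarrow>\<^sub>0 'k::field) set"
  where "deg_ge d k = {p. \<forall>w\<in>Poly_Mapping.keys p. w \<in> words d \<and> len w \<ge> k}"

lemma free_algebra_eq: "free_algebra d = deg_ge d 1"
  by (auto simp: free_algebra_def deg_ge_def free_semigroup_iff)

lemma deg_ge_zero: "0 \<in> deg_ge d k"
  by (simp add: deg_ge_def)

lemma deg_ge_mono: "p \<in> deg_ge d k \<Longrightarrow> j \<le> k \<Longrightarrow> p \<in> deg_ge d j"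
  by (force simp: deg_ge_def)

lemma deg_ge_add: "p \<in> deg_ge d k \<Longrightarrow> q \<in> deg_ge d k \<Longrightarrow> p + q \<in> deg_ge d k"
  using Poly_Mapping.keys_add[of p q] by (auto simp: deg_ge_def)

lemma deg_ge_sum: "(\<And>i. i \<in> S \<Longrightarrow> f i \<in> deg_ge d k) \<Longrightarrow> sum f S \<in> deg_ge d k"
  by (induction S rule: infinite_finite_induct) (auto simp: deg_ge_zero deg_ge_add)

lemma deg_ge_mult: "p \<in> deg_ge d j \<Longrightarrow> q \<in> deg_ge d k \<Longrightarrow> p * q \<in> deg_ge d (j + k)"
  using keys_mult[of p q] by (force simp: deg_ge_def)

lemma deg_ge_single: "w \<in> words d \<Longrightarrow> len w \<ge> k \<Longrightarrow> Poly_Mapping.single w c \<in> deg_ge d k"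
  by (simp add: deg_ge_def)

lemma deg_ge_power: "p \<in> deg_ge d k \<Longrightarrow> p ^ j \<in> deg_ge d (j * k)"
  by (induction j) (auto intro: deg_ge_mult deg_ge_single simp flip: single_one)

text \<open>Every product in \<open>lin1 a b k\<close> has \<open>k\<close> factors \<open>a\<close>
  and one factor \<open>b\<close>.\<close>

lemma deg_ge_lin1:
  "a \<in> deg_ge d i \<Longrightarrow> b \<in> deg_ge d j \<Longrightarrow> lin1 a b k \<in> deg_ge d (k * i + j)"
proof (induction k)
  case (Suc k)
  have "a * lin1 a b k \<in> deg_ge d (i + (k * i + j))"
    using Suc by (intro deg_ge_mult)
  moreover have "b * a ^ Suc k \<in> deg_ge d (j + Suc k * i)"
    using Suc by (intro deg_ge_mult deg_ge_power)
  ultimately show ?case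
    by (simp add: add_ac deg_ge_add)
qed simp

lemma sum_single_lookup: "(\<Sum>w\<in>Poly_Mapping.keys p. Poly_Mapping.single w (Poly_Mapping.lookup p w)) = p"
  by (intro poly_mapping_eqI)
    (simp add: lookup_sum lookup_single when_def sum.If_cases in_keys_iff if_distrib cong: if_cong)

lemma lin1_scale:
  fixes a b :: "'m::monoid_add \<Rightarrow>\<^sub>0 'k::field"
  shows
  "lin1 a (Poly_Mapping.single 0 c * b) k = Poly_Mapping.single 0 c * lin1 a b k"
proof (induction k)
  case (Suc k)
  have "a * (Poly_Mapping.single 0 c * p) = Poly_Mapping.single 0 c * (a * p)" for p
    by (metis mult.assoc single_zero_central)
  then show ?case
    by (simp add: Suc distrib_left mult.assoc)
qed simp

lemma prod_list_word: "prod_list (map word ws) = word (sum_list ws)"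
  by (induction ws) (simp_all add: mult_single)

text \<open>Written as a sum of single words instead of a product, so that a map on coefficients can
  be applied term by term.\<close>

definition sym_gen :: "nat fmonoid \<Rightarrow> nat fmonoid multiset \<Rightarrow> nat fmonoid \<Rightarrow> 'k::field \<Rightarrow>
    (nat fmonoid \<Rightarrow>\<^sub>0 'k)"
  where "sym_gen u M v c =
    (\<Sum>ws\<in>permutations_of_multiset M. Poly_Mapping.single (u + sum_list ws + v) c)"

lemma sym_gen_eq: "sym_gen u M v c = Poly_Mapping.single u c * symsum word M * word v"
  by (simp add: sym_gen_def symsum_def prod_list_word sum_distrib_left sum_distrib_right mult_single)

lemma single_mult_sym_gen:
  "Poly_Mapping.single w k * sym_gen u M v c = sym_gen (w + u) M v (k * c)"
  by (simp add: sym_gen_def sum_distrib_left mult_single add.assoc)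

lemma sym_gen_mult_single:
  "sym_gen u M v c * Poly_Mapping.single w k = sym_gen u M (v + w) (c * k)"
  by (simp add: sym_gen_def sum_distrib_right mult_single add.assoc)

text \<open>Restricting the length of the words to \<open>L = {m}\<close> isolates the homogeneous component of degree \<open>m\<close>.\<close>

inductive_set sym_span :: "nat \<Rightarrow> nat \<Rightarrow> nat set \<Rightarrow> (nat fmonoid \<Rightarrow>\<^sub>0 'k::field) set"
  for n d :: nat and L :: "nat set" where
  zero: "0 \<in> sym_span n d L"
| add: "p \<in> sym_span n d L \<Longrightarrow> q \<in> sym_span n d L \<Longrightarrow> p + q \<in> sym_span n d L"
| gen: "size M = n \<Longrightarrow> set_mset M \<subseteq> free_semigroup d \<Longrightarrow> u \<in> words d \<Longrightarrow> v \<in> words d \<Longrightarrow>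
    len u + (\<Sum>w\<in>#M. len w) + len v \<in> L \<Longrightarrow> sym_gen u M v c \<in> sym_span n d L"

lemma sym_span_sum: "(\<And>i. i \<in> S \<Longrightarrow> f i \<in> sym_span n d L) \<Longrightarrow> sum f S \<in> sym_span n d L"
  by (induction S rule: infinite_finite_induct) (auto intro: sym_span.intros)

lemma words_sum_list: "set ws \<subseteq> words d \<Longrightarrow> sum_list ws \<in> words d"
  by (induction ws) auto

lemma len_perm:
  "ws \<in> permutations_of_multiset M \<Longrightarrow> len (u + sum_list ws + v) = len u + (\<Sum>w\<in>#M. len w) + len v"
  by (auto simp: len_sum_list dest!: permutations_of_multisetD simp flip: sum_mset_sum_list)

lemma sym_span_subset:
  assumes "n > 0" "p \<in> sym_span n d L"
  shows "p \<in> free_algebra d"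
  using assms(2) unfolding free_algebra_eq
proof induction
  case (gen M u v c)
  show ?case
    unfolding sym_gen_def
  proof (intro deg_ge_sum deg_ge_single)
    fix ws assume ws: "ws \<in> permutations_of_multiset M"
    then have mset: "mset ws = M"
      by (rule permutations_of_multisetD)
    then have "set ws \<subseteq> free_semigroup d" "length ws = n"
      using gen by (metis set_mset_mset, metis size_mset)
    moreover from this obtain w ws' where "ws = w # ws'"
      using assms(1) by (cases ws) auto
    moreover have "sum_list ws \<in> words d"
      using calculation(1) by (intro words_sum_list) (auto simp: free_semigroup_iff)
    ultimately show "u + sum_list ws + v \<in> words d" "1 \<le> len (u + sum_list ws + v)"
      using gen by (auto simp: free_semigroup_iff)
  qed
qed (auto intro: deg_ge_zero deg_ge_add)

lemma sym_span_single_mult: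
  "p \<in> sym_span n d UNIV \<Longrightarrow> w \<in> words d \<Longrightarrow> Poly_Mapping.single w k * p \<in> sym_span n d UNIV"
  by (induction rule: sym_span.induct)
    (auto simp: distrib_left single_mult_sym_gen intro: sym_span.intros)

lemma sym_span_mult_single:
  "p \<in> sym_span n d UNIV \<Longrightarrow> w \<in> words d \<Longrightarrow> p * Poly_Mapping.single w k \<in> sym_span n d UNIV"
  by (induction rule: sym_span.induct)
    (auto simp: distrib_right sym_gen_mult_single intro: sym_span.intros)

lemma is_ideal_sym_span: "n > 0 \<Longrightarrow> is_ideal d (sym_span n d UNIV)"
  unfolding is_ideal_def
proof (intro conjI ballI allI)
  fix p a :: "nat fmonoid \<Rightarrow>\<^sub>0 'a" assume p: "p \<in> sym_span n d UNIV" and "a \<in> free_algebra d"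
  then have w: "w \<in> words d" if "w \<in> Poly_Mapping.keys a" for w
    using that by (auto simp: free_algebra_def free_semigroup_iff)
  have "(\<Sum>w\<in>Poly_Mapping.keys a. Poly_Mapping.single w (Poly_Mapping.lookup a w)) * p \<in> sym_span n d UNIV"
    unfolding sum_distrib_right by (intro sym_span_sum sym_span_single_mult p w)
  then show "a * p \<in> sym_span n d UNIV"
    by (simp only: sum_single_lookup)
  have "p * (\<Sum>w\<in>Poly_Mapping.keys a. Poly_Mapping.single w (Poly_Mapping.lookup a w)) \<in> sym_span n d UNIV"
    unfolding sum_distrib_left by (intro sym_span_sum sym_span_mult_single p w)
  then show "p * a \<in> sym_span n d UNIV"
    by (simp only: sum_single_lookup)
qed (auto intro: sym_span.intros sym_span_subset
    simp: mult_map_scale_conv_mult sym_span_single_mult)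

text \<open>Expanding \<open>x ^ n\<close> over the words of \<open>x\<close> and grouping by
  content gives scaled generators, over any field.\<close>

lemma power_ideal_subset_sym_span:
  assumes "n > 0"
  shows "power_ideal n d \<subseteq> sym_span n d UNIV"
  unfolding power_ideal_def
proof (rule hull_minimal)
  show "{x ^ n |x. x \<in> free_algebra d} \<subseteq> (sym_span n d UNIV :: (nat fmonoid \<Rightarrow>\<^sub>0 'a) set)"
  proof clarify
    fix x :: "nat fmonoid \<Rightarrow>\<^sub>0 'a" assume x: "x \<in> free_algebra d"
    have "(\<Sum>w\<in>Poly_Mapping.keys x. Poly_Mapping.single 0 (Poly_Mapping.lookup x w) * word w) ^ n \<in> sym_span n d UNIV"
      unfolding power_sum_eq_symsum[OF finite_keys]
    proof (rule sym_span_sum)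
      fix M assume M: "M \<in> {M. size M = n \<and> set_mset M \<subseteq> Poly_Mapping.keys x}"
      then have "symsum (\<lambda>w. Poly_Mapping.single 0 (Poly_Mapping.lookup x w) * word w) M =
          sym_gen 0 M 0 (\<Prod>w\<in>Poly_Mapping.keys x. Poly_Mapping.lookup x w ^ count M w)"
        by (subst symsum_scale[OF finite_keys]) (auto simp: sym_gen_eq)
      also have "\<dots> \<in> sym_span n d UNIV"
        using M x by (intro sym_span.gen) (auto simp: free_algebra_def)
      finally show "symsum (\<lambda>w. Poly_Mapping.single 0 (Poly_Mapping.lookup x w) * word w) M \<in> sym_span n d UNIV" .
    qed
    then show "x ^ n \<in> sym_span n d UNIV"
      by (simp add: mult_single sum_single_lookup)
  qed
qed (rule is_ideal_sym_span[OF assms])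

section \<open>Transfer of the span between fields\<close>

lemma lookup_mapp_zero:
  "f w 0 = 0 \<Longrightarrow> Poly_Mapping.lookup (Poly_Mapping.mapp f p) w = f w (Poly_Mapping.lookup p w)"
  by (auto simp: mapp.rep_eq when_def in_keys_iff)

text \<open>All words of a generator have the same length, so it is mapped to zero or to the same
  generator with coefficient \<open>\<phi> c\<close>. Additivity of \<open>\<phi>\<close> also
  covers arrangements that yield the same word.\<close>

lemma sym_span_transfer:
  fixes \<phi> :: "'a::field \<Rightarrow> 'b::field"
  assumes add: "\<And>x y. \<phi> (x + y) = \<phi> x + \<phi> y"
    and "p \<in> sym_span n d UNIV"
  shows "Poly_Mapping.mapp (\<lambda>w c. if len w = m then \<phi> c else 0) p \<in> sym_span n d {m}"
    (is "?f p \<in> _")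
  using assms(2)
proof induction
  have \<phi>0: "\<phi> 0 = 0"
    using add[of 0 0] by (metis add_0_right add_left_cancel)
  note lookup = lookup_mapp_zero[of "\<lambda>w c. if len w = m then \<phi> c else 0"]
  have f0: "?f 0 = 0"
    by (intro poly_mapping_eqI) (simp add: lookup \<phi>0)
  have f_add: "?f (p + q) = ?f p + ?f q" for p q
    by (intro poly_mapping_eqI) (simp add: lookup \<phi>0 lookup_add add)
  have f_single: "?f (Poly_Mapping.single w c) = Poly_Mapping.single w (if len w = m then \<phi> c else 0)" for w c
    by (intro poly_mapping_eqI) (auto simp: lookup \<phi>0 lookup_single when_def)
  have f_sum: "?f (sum g S) = (\<Sum>x\<in>S. ?f (g x))" for g :: "nat fmonoid list \<Rightarrow> _" and S
    by (induction S rule: infinite_finite_induct) (simp_all add: f0 f_add)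
  {
    case zero
    show ?case by (simp add: f0 sym_span.zero)
  next
    case (add p q)
    then show ?case by (simp add: f_add sym_span.add)
  next
    case (gen M u v c)
    let ?l = "len u + (\<Sum>w\<in>#M. len w) + len v"
    have "?f (sym_gen u M v c) = sym_gen u M v (if ?l = m then \<phi> c else 0)"
      unfolding sym_gen_def f_sum f_single by (intro sum.cong refl) (simp only: len_perm)
    also have "\<dots> \<in> sym_span n d {m}"
    proof (cases "?l = m")
      case True
      then show ?thesis using gen by (auto intro: sym_span.gen)
    qed (simp add: sym_gen_def sym_span.zero)
    finally show ?case .
  }
qed

text \<open>The normalization \<open>\<phi> 1 = 1\<close> fixes the word itself, and restricting
  lengths makes the membership homogeneous.\<close>

lemma word_in_sym_span_transfer:
  assumes "CHAR('a::field) = CHAR('b::field)" "CHAR('a) > 0"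
    and "(word w :: nat fmonoid \<Rightarrow>\<^sub>0 'a) \<in> sym_span n d UNIV"
  shows "(word w :: nat fmonoid \<Rightarrow>\<^sub>0 'b) \<in> sym_span n d {len w}"
proof -
  obtain \<phi> :: "'a \<Rightarrow> 'b" where \<phi>: "\<And>x y. \<phi> (x + y) = \<phi> x + \<phi> y" "\<phi> 1 = 1"
    using exists_additive_map[OF assms(1,2)] by metis
  have "\<phi> 0 = 0"
    using \<phi>(1)[of 0 0] by (metis add_0_right add_left_cancel)
  then have "Poly_Mapping.mapp (\<lambda>v c. if len v = len w then \<phi> c else 0) (word w) = word w"
    by (intro poly_mapping_eqI) (auto simp: lookup_mapp_zero lookup_single when_def \<phi>(2))
  then show ?thesis
    using sym_span_transfer[of \<phi>, OF \<phi>(1) assms(3), of "len w"] by simp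
qed

section \<open>The ideal of powers\<close>

lemma power_ideal_add: "n > 0 \<Longrightarrow> p \<in> power_ideal n d \<Longrightarrow> q \<in> power_ideal n d \<Longrightarrow> p + q \<in> power_ideal n d"
  and power_ideal_zero: "n > 0 \<Longrightarrow> 0 \<in> power_ideal n d"
  and power_ideal_scale: "n > 0 \<Longrightarrow> p \<in> power_ideal n d \<Longrightarrow> Poly_Mapping.single 0 c * p \<in> power_ideal n d"
  and power_ideal_mult_left: "n > 0 \<Longrightarrow> a \<in> free_algebra d \<Longrightarrow> p \<in> power_ideal n d \<Longrightarrow> a * p \<in> power_ideal n d"
  and power_ideal_mult_right: "n > 0 \<Longrightarrow> a \<in> free_algebra d \<Longrightarrow> p \<in> power_ideal n d \<Longrightarrow> p * a \<in> power_ideal n d"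
  using is_ideal_power_ideal[of n d] by (auto simp: is_ideal_def mult_map_scale_conv_mult)

lemma power_ideal_uminus: "n > 0 \<Longrightarrow> p \<in> power_ideal n d \<Longrightarrow> - p \<in> power_ideal n d"
  using power_ideal_scale[of n p d "- 1"] by (simp add: single_uminus)

lemma power_ideal_sum:
  "n > 0 \<Longrightarrow> (\<And>i. i \<in> S \<Longrightarrow> f i \<in> power_ideal n d) \<Longrightarrow> sum f S \<in> power_ideal n d"
  by (induction S rule: infinite_finite_induct) (auto intro: power_ideal_zero power_ideal_add)

lemma power_in_power_ideal: "x \<in> free_algebra d \<Longrightarrow> x ^ n \<in> power_ideal n d"
  unfolding power_ideal_def by (intro hull_inc) auto

lemma single_scale_mult: "Poly_Mapping.single u c = Poly_Mapping.single 0 c * word u"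
  by (simp add: mult_single)

lemma word_in_free_algebra: "w \<in> words d \<Longrightarrow> len w \<ge> 1 \<Longrightarrow> Poly_Mapping.single w c \<in> free_algebra d"
  unfolding free_algebra_eq by (rule deg_ge_single)

lemma word_len_zero: "\<not> len w \<ge> 1 \<Longrightarrow> w = 0"
  by (cases w; cases "letters w") (auto simp: zero_fmonoid_def)

lemma power_ideal_single_left:
  assumes "n > 0" "u \<in> words d" "p \<in> power_ideal n d"
  shows "Poly_Mapping.single u c * p \<in> power_ideal n d"
\<comment> \<open>The empty word lies outside the free algebra, so the ideal property does not cover
  it; it acts as a scalar.\<close>
proof (cases "len u \<ge> 1")
  case False
  then show ?thesis
    using power_ideal_scale assms word_len_zero[OF False] by auto
qed (use assms power_ideal_mult_left word_in_free_algebra in blast)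

lemma power_ideal_single_right:
  assumes "n > 0" "u \<in> words d" "p \<in> power_ideal n d"
  shows "p * Poly_Mapping.single u c \<in> power_ideal n d"
proof (cases "len u \<ge> 1")
  case False
  then have "p * Poly_Mapping.single u c = Poly_Mapping.single 0 c * p"
    using word_len_zero[OF False] by (simp add: single_zero_central)
  then show ?thesis
    using power_ideal_scale assms by auto
qed (use assms power_ideal_mult_right word_in_free_algebra in blast)

text \<open>A multiplicity below \<open>CARD('k)\<close> leaves enough points for the divided
  difference.\<close>

lemma symsum_in_power_ideal:
  fixes y :: "'i \<Rightarrow> nat fmonoid \<Rightarrow>\<^sub>0 'k::field"
  assumes "n > 0" "size M = n" "\<And>i. i \<in># M \<Longrightarrow> y i \<in> free_algebra d"
    and "\<And>i. infinite (UNIV :: 'k set) \<or> count M i < CARD('k)"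
  shows "symsum y M \<in> power_ideal n d"
proof (rule symsum_in_subspace)
  fix a :: "'i \<Rightarrow> 'k"
  have "(\<Sum>i\<in>set_mset M. Poly_Mapping.single 0 (a i) * y i) \<in> free_algebra d"
    unfolding free_algebra_eq
  proof (intro deg_ge_sum)
    fix i assume "i \<in># M"
    then have "Poly_Mapping.single 0 (a i) * y i \<in> deg_ge d (0 + 1)"
      using assms(3) by (intro deg_ge_mult deg_ge_single) (auto simp: free_algebra_eq)
    then show "Poly_Mapping.single 0 (a i) * y i \<in> deg_ge d 1"
      by simp
  qed
  then show "(\<Sum>i\<in>set_mset M. Poly_Mapping.single 0 (a i) * y i) ^ size M \<in> power_ideal n d"
    using assms(2) power_in_power_ideal by blast
next
  fix i
  show "\<exists>S::'k set. finite S \<and> card S = Suc (count M i)"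
  proof (cases "finite (UNIV :: 'k set)")
    case True
    then have "Suc (count M i) \<le> CARD('k)"
      using assms(4)[of i] by auto
    then show ?thesis
      using True by (metis obtain_subset_with_card_n)
  qed (use infinite_arbitrarily_large in blast)
qed (auto intro: power_ideal_zero power_ideal_add power_ideal_scale assms(1))

lemma sym_gen_in_power_ideal:
  fixes c :: "'k::field"
  assumes "n > 0" "size M = n" "set_mset M \<subseteq> free_semigroup d" "u \<in> words d" "v \<in> words d"
    and "\<And>i. infinite (UNIV :: 'k set) \<or> count M i < CARD('k)"
  shows "sym_gen u M v c \<in> power_ideal n d"
  unfolding sym_gen_eq using assms
  by (intro power_ideal_single_left power_ideal_single_right symsum_in_power_ideal word_in_free_algebra)
    (auto simp: free_semigroup_iff)

lemma sym_span_subset_power_ideal: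
  fixes p :: "nat fmonoid \<Rightarrow>\<^sub>0 'k::field"
  assumes "infinite (UNIV :: 'k set)" "n > 0" "p \<in> sym_span n d L"
  shows "p \<in> power_ideal n d"
  using assms(3)
proof induction
  case (gen M u v c)
  then show ?case
    using assms(1,2) by (intro sym_gen_in_power_ideal) auto
qed (auto intro: power_ideal_zero power_ideal_add assms(2))

section \<open>Nilpotency in terms of words\<close>

definition nil_words :: "'k::field itself \<Rightarrow> nat \<Rightarrow> nat \<Rightarrow> nat \<Rightarrow> bool"
  where "nil_words TYPE('k) n d c \<longleftrightarrow>
    (\<forall>w\<in>words d. len w = c \<longrightarrow> (word w :: nat fmonoid \<Rightarrow>\<^sub>0 'k) \<in> power_ideal n d)"

lemma deg_ge_subset_power_ideal:
  fixes p :: "nat fmonoid \<Rightarrow>\<^sub>0 'k::field"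
  assumes "n > 0"
    and "\<And>w. w \<in> words d \<Longrightarrow> len w \<ge> k \<Longrightarrow> (word w :: nat fmonoid \<Rightarrow>\<^sub>0 'k) \<in> power_ideal n d"
    and "p \<in> deg_ge d k"
  shows "p \<in> power_ideal n d"
proof -
  have "(\<Sum>w\<in>Poly_Mapping.keys p. Poly_Mapping.single w (Poly_Mapping.lookup p w)) \<in> power_ideal n d"
  proof (rule power_ideal_sum[OF assms(1)])
    fix w assume "w \<in> Poly_Mapping.keys p"
    then have "(word w :: nat fmonoid \<Rightarrow>\<^sub>0 'k) \<in> power_ideal n d"
      using assms(2,3) by (auto simp: deg_ge_def)
    then show "Poly_Mapping.single w (Poly_Mapping.lookup p w) \<in> power_ideal n d"
      by (subst single_scale_mult) (rule power_ideal_scale[OF assms(1)])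
  qed
  then show ?thesis
    by (simp only: sum_single_lookup)
qed

lemma split_word:
  assumes "w \<in> words d" "k \<le> len w"
  obtains u v where "w = u + v" "u \<in> words d" "v \<in> words d" "len u = k" "len v = len w - k"
proof
  show "w = Word (take k (letters w)) + Word (drop k (letters w))"
    by (cases w) (simp add: plus_fmonoid_def)
  show "Word (take k (letters w)) \<in> words d" "Word (drop k (letters w)) \<in> words d"
    using assms(1) set_take_subset set_drop_subset by (fastforce simp: words_def)+
qed (use assms(2) in auto)

lemma nil_words_mono:
  assumes "n > 0" "nil_words TYPE('k::field) n d c" "w \<in> words d" "c \<le> len w"
  shows "(word w :: nat fmonoid \<Rightarrow>\<^sub>0 'k) \<in> power_ideal n d"
proof -
  obtain u v where uv: "w = u + v" "u \<in> words d" "v \<in> words d" "len u = c"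
    using split_word[OF assms(3,4)] by metis
  then have "(word u :: nat fmonoid \<Rightarrow>\<^sub>0 'k) \<in> power_ideal n d"
    using assms(2) by (auto simp: nil_words_def)
  then have "word u * (word v :: nat fmonoid \<Rightarrow>\<^sub>0 'k) \<in> power_ideal n d"
    using uv assms(1) by (intro power_ideal_single_right)
  then show ?thesis
    by (simp add: uv(1) mult_single)
qed

lemma coset_eq_iff:
  fixes a :: "nat fmonoid \<Rightarrow>\<^sub>0 'k::field"
  assumes "n > 0"
  shows "coset n d a = coset n d 0 \<longleftrightarrow> a \<in> power_ideal n d"
proof
  assume "coset n d a = coset n d 0"
  moreover have "a \<in> coset n d a"
    using power_ideal_zero[OF assms] by (force simp: coset_def)
  ultimately show "a \<in> power_ideal n d"
    by (auto simp: coset_def)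
next
  assume a: "a \<in> power_ideal n d"
  show "coset n d a = coset n d 0"
  proof
    show "coset n d a \<subseteq> coset n d 0"
      using a power_ideal_add[OF assms] by (auto simp: coset_def)
    show "coset n d 0 \<subseteq> coset n d a"
    proof
      fix p :: "nat fmonoid \<Rightarrow>\<^sub>0 'k" assume "p \<in> coset n d 0"
      then have "p + - a \<in> power_ideal n d"
        by (intro power_ideal_add power_ideal_uminus assms a) (auto simp: coset_def)
      then show "p \<in> coset n d a"
        by (force simp: coset_def intro: exI[of _ "p + - a"])
    qed
  qed
qed

lemma foldl_N_mult:
  fixes a :: "nat fmonoid \<Rightarrow>\<^sub>0 'k::field"
  assumes "n > 0"
  shows "a \<in> free_algebra d \<Longrightarrow> set bs \<subseteq> free_algebra d \<Longrightarrow>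
    foldl (N_mult n d) (coset n d a) (map (coset n d) bs) = coset n d (a * prod_list bs)"
proof (induction bs arbitrary: a)
  case (Cons b bs)
  have "a * b \<in> free_algebra d"
    using deg_ge_mono[OF deg_ge_mult[of a d 1 b 1], of 1] Cons.prems by (simp add: free_algebra_eq)
  then show ?case
    using Cons by (simp add: N_mult_coset[OF assms] mult.assoc)
qed simp

text \<open>A product of \<open>c\<close> elements involves only words of length at least
  \<open>c\<close>; conversely, a word of length \<open>c\<close> is a product of \<open>c\<close>
  letters.\<close>

lemma nil_words_iff:
  assumes "n > 0" "c > 0"
  shows "(\<forall>as. length as = c \<and> set as \<subseteq> (N_carrier n d :: (nat fmonoid \<Rightarrow>\<^sub>0 'k::field) set set) \<longrightarrow>
        foldl (N_mult n d) (hd as) (tl as) = coset n d 0) \<longleftrightarrow> nil_words TYPE('k) n d c"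
    (is "?L \<longleftrightarrow> ?R")
proof
  assume L: ?L
  show ?R
    unfolding nil_words_def
  proof (intro ballI impI)
    fix w assume w: "w \<in> words d" "len w = c"
    then obtain x xs where x: "letters w = x # xs"
      using assms(2) by (cases "letters w") auto
    define g :: "nat \<Rightarrow> nat fmonoid \<Rightarrow>\<^sub>0 'k" where "g l = word (Word [l])" for l
    have g: "g l \<in> free_algebra d" if "l \<in> set (letters w)" for l
      using that w unfolding g_def by (intro word_in_free_algebra) (auto simp: words_def)
    have prod: "prod_list (map g ls) = word (Word ls)" for ls
      by (induction ls) (simp_all add: g_def mult_single plus_fmonoid_def flip: single_one zero_fmonoid_def)
    define as where "as = map (coset n d) (map g (letters w))"
    have "length as = c" "set as \<subseteq> N_carrier n d"
      using w g by (auto simp: as_def N_carrier_def)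
    then have "foldl (N_mult n d) (hd as) (tl as) = coset n d 0"
      using L by blast
    also have "hd as = coset n d (g x)"
      by (simp add: as_def x)
    also have "tl as = map (coset n d) (map g xs)"
      by (simp add: as_def x)
    finally have "coset n d (g x * prod_list (map g xs)) = coset n d 0"
      using g x by (subst (asm) foldl_N_mult[OF assms(1)]) auto
    then have "coset n d (prod_list (map g (letters w))) = coset n d 0"
      by (simp add: x)
    then show "word w \<in> (power_ideal n d :: (nat fmonoid \<Rightarrow>\<^sub>0 'k) set)"
      by (simp add: prod coset_eq_iff[OF assms(1)])
  qed
next
  assume R: ?R
  show ?L
  proof (intro allI impI, elim conjE)
    fix as :: "(nat fmonoid \<Rightarrow>\<^sub>0 'k) set list"
    assume as: "length as = c" "set as \<subseteq> N_carrier n d"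
    have "as \<in> lists (coset n d ` free_algebra d)"
      using as(2) by (auto simp: N_carrier_def)
    then have "as \<in> map (coset n d) ` lists (free_algebra d)"
      by (simp only: lists_image)
    then obtain bs where bs: "as = map (coset n d) bs" "set bs \<subseteq> free_algebra d"
      by auto
    then obtain b bs' where b: "bs = b # bs'"
      using as(1) assms(2) by (cases bs) auto
    have "prod_list bs \<in> deg_ge d (length bs)"
      using bs(2)
    proof (induction bs)
      case (Cons x xs)
      then show ?case
        using deg_ge_mult[of x d 1 "prod_list xs" "length xs"] by (simp add: free_algebra_eq)
    qed (use deg_ge_single[of 0 d 0] in \<open>simp flip: single_one\<close>)
    then have "prod_list bs \<in> deg_ge d c"
      using as(1) bs(1) by simp
    then have "prod_list bs \<in> power_ideal n d"
      by (rule deg_ge_subset_power_ideal[OF assms(1) _, rotated]) (rule nil_words_mono[OF assms(1) R])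
    then show "foldl (N_mult n d) (hd as) (tl as) = coset n d 0"
      using bs(2) by (simp add: bs(1) b foldl_N_mult[OF assms(1)] coset_eq_iff[OF assms(1)])
  qed
qed

lemma nilpotency_degree_eq:
  assumes "n > 0"
  shows "nilpotency_degree TYPE('k::field) n d = (LEAST c. c > 0 \<and> nil_words TYPE('k) n d c)"
  unfolding nilpotency_degree_def
  by (rule arg_cong[of _ _ Least], rule ext, rule conj_cong[OF refl], rule nil_words_iff[OF assms])

text \<open>The words pass from the ideal to the span over \<open>'f\<close>, then to the span over
  \<open>'l\<close>, which lies in the ideal because \<open>'l\<close> is infinite.\<close>

lemma nil_words_infinite_field:
  assumes "n > 0" "infinite (UNIV :: 'l::field set)"
    and "CHAR('f::field) = CHAR('l)" "CHAR('f) > 0"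
    and "nil_words TYPE('f) n d c"
  shows "nil_words TYPE('l) n d c"
  unfolding nil_words_def
proof (intro ballI impI)
  fix w assume "w \<in> words d" "len w = c"
  then have "(word w :: nat fmonoid \<Rightarrow>\<^sub>0 'f) \<in> sym_span n d UNIV"
    using assms(5) power_ideal_subset_sym_span[OF assms(1)] by (auto simp: nil_words_def)
  then show "(word w :: nat fmonoid \<Rightarrow>\<^sub>0 'l) \<in> power_ideal n d"
    using word_in_sym_span_transfer assms sym_span_subset_power_ideal by blast
qed

section \<open>Fields with \<open>n - 1\<close> elements\<close>

lemma nil_ideal_power_ideal:
  assumes q: "q \<ge> 2" "CARD('k::{field,finite}) = q"
  shows "nil_ideal (free_algebra d) (power_ideal (Suc q) d :: (nat fmonoid \<Rightarrow>\<^sub>0 'k) set) q"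
proof
  let ?A = "free_algebra d :: (nat fmonoid \<Rightarrow>\<^sub>0 'k) set"
  let ?I = "power_ideal (Suc q) d :: (nat fmonoid \<Rightarrow>\<^sub>0 'k) set"
  fix a b assume a: "a \<in> ?A" and b: "b \<in> ?A"
  show "a * b \<in> ?A"
    using deg_ge_mono[OF deg_ge_mult[of a d 1 b 1], of 1] a b by (simp add: free_algebra_eq)
  show "lin2 a b x (q - 1) \<in> ?I" if x: "x \<in> ?A" for x
  proof -
    \<comment> \<open>Separate indices keep \<open>a\<close>, \<open>b\<close> and \<open>x\<close>
      apart even if they coincide; their multiplicities \<open>q - 1\<close>, 1, 1 are below
      \<open>q\<close>.\<close>
    define y where "y i = (if i = 0 then a else if i = 1 then b else x)" for i :: nat
    have "symsum y (add_mset 1 (add_mset 2 (replicate_mset (q - 1) 0))) \<in> ?I"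
      using q a b x by (intro symsum_in_power_ideal) (auto simp: y_def)
    then show ?thesis
      by (subst (asm) symsum_lin2) (auto simp: y_def)
  qed
  show "lin1 a b q + lin1 b a q \<in> ?I"
  proof -
    define y where "y i = (if i = 0 then a else b)" for i :: nat
    have y: "y i \<in> ?A" for i
      using a b by (simp add: y_def)
    \<comment> \<open>These are the contents of the words in \<open>(a + b) ^ Suc q\<close>. All
      components except those of \<open>M1\<close> and \<open>M2\<close> are shown to lie in the
      ideal one by one, hence so does the sum of these two.\<close>
    define N where "N = {M. size M = Suc q \<and> set_mset M \<subseteq> {0, 1::nat}}"
    define M1 where "M1 = add_mset 1 (replicate_mset q (0::nat))"
    define M2 where "M2 = add_mset 0 (replicate_mset q (1::nat))"
    have N: "finite N"
      unfolding N_def by (rule finite_msets_of_size) simp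
    have "count M1 0 \<noteq> count M2 0"
      using q by (simp add: M1_def M2_def)
    then have ne: "M1 \<noteq> M2"
      by metis
    have M12: "M1 \<in> N" "M2 \<in> N - {M1}"
      using ne by (auto simp: N_def M1_def M2_def)
    have "symsum y M \<in> ?I" if M: "M \<in> N - {M1} - {M2}" for M
    proof (cases "\<forall>i. count M i < q")
      case True
      then show ?thesis
        using M q y by (intro symsum_in_power_ideal) (auto simp: N_def)
    next
      \<comment> \<open>Multiplicity at least \<open>q\<close> leaves room for one more letter, so
        only pure powers remain besides \<open>M1\<close> and \<open>M2\<close>.\<close>
      case False
      then obtain i where "q \<le> count M i"
        by (auto simp: not_less)
      then obtain M' where M': "M = M' + replicate_mset q i"
        by (metis count_le_replicate_mset_subset_eq subset_mset.diff_add)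
      then have "size M' = 1"
        using M by (simp add: N_def)
      then obtain j where j: "M = add_mset j (replicate_mset q i)"
        using M' by (metis One_nat_def size_1_singleton_mset add_mset_add_single union_commute)
      have "set_mset M \<subseteq> {0, 1}"
        using M by (simp add: N_def)
      then have "i \<in> {0, 1}" "j \<in> {0, 1}"
        using j q by auto
      then have "i = j"
        using M j by (auto simp: M1_def M2_def)
      then have "M = replicate_mset (Suc q) i"
        using j by simp
      then show ?thesis
        using power_in_power_ideal[OF y] by (simp only: symsum_replicate)
    qed
    then have rest: "(\<Sum>M\<in>N - {M1} - {M2}. symsum y M) \<in> ?I"
      by (intro power_ideal_sum) auto
    have "(\<Sum>i\<in>{0, 1}. y i) ^ Suc q \<in> ?I"
      using deg_ge_add a b by (intro power_in_power_ideal) (simp add: y_def free_algebra_eq)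
    then have total: "(\<Sum>M\<in>N. symsum y M) \<in> ?I"
      by (subst (asm) power_sum_eq_symsum) (simp_all only: N_def finite.intros)
    have "(\<Sum>M\<in>N. symsum y M) =
        symsum y M1 + (symsum y M2 + (\<Sum>M\<in>N - {M1} - {M2}. symsum y M))"
      using N M12 by (simp only: sum.remove finite_Diff)
    moreover have "symsum y M1 = lin1 a b q"
      unfolding M1_def by (subst symsum_lin1) (auto simp: y_def)
    moreover have "symsum y M2 = lin1 b a q"
      unfolding M2_def by (subst symsum_lin1) (auto simp: y_def)
    ultimately have "lin1 a b q + lin1 b a q =
        (\<Sum>M\<in>N. symsum y M) + - (\<Sum>M\<in>N - {M1} - {M2}. symsum y M)"
      by simp
    then show ?thesis
      by (simp only:) (intro power_ideal_add power_ideal_uminus rest total zero_less_Suc)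
  qed
  show "a * x \<in> ?I" "x * a \<in> ?I" if "x \<in> ?I" for x
    using power_ideal_mult_left[OF _ a that] power_ideal_mult_right[OF _ a that] by simp_all
  show "a ^ Suc q \<in> ?I"
    by (rule power_in_power_ideal[OF a])
next
  fix x y :: "nat fmonoid \<Rightarrow>\<^sub>0 'k"
  assume "x \<in> power_ideal (Suc q) d" "y \<in> power_ideal (Suc q) d"
  then show "x + y \<in> power_ideal (Suc q) d" "- x \<in> power_ideal (Suc q) d"
    by (simp_all add: power_ideal_add power_ideal_uminus)
qed (use q power_ideal_zero in auto)

text \<open>If some multiplicity reaches \<open>q\<close>, then \<open>M\<close> consists of
  \<open>q\<close> copies of a word \<open>a\<close> and one more word \<open>b\<close>. For
  \<open>a = b\<close> this gives a power, otherwise \<open>lin1\<close>.\<close>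

lemma sym_gen_cases:
  fixes c :: "'k::{field,finite}"
  assumes q: "q \<ge> 2" "CARD('k) = q"
    and M: "size M = Suc q" "set_mset M \<subseteq> free_semigroup d"
    and uv: "u \<in> words d" "v \<in> words d"
  shows "sym_gen u M v c \<in> power_ideal (Suc q) d \<or>
    (\<exists>a\<in>free_semigroup d. \<exists>b\<in>free_semigroup d. (\<Sum>w\<in>#M. len w) = q * len a + len b \<and>
      sym_gen u M v c = Poly_Mapping.single u c * lin1 (word a) (word b) q * word v)"
proof (cases "\<forall>i. count M i < q")
  case True
  then show ?thesis
    using sym_gen_in_power_ideal[of "Suc q" M d u v c] assms by auto
next
  case False
  then obtain a where "q \<le> count M a"
    by (auto simp: not_less)
  then obtain M' where M': "M = M' + replicate_mset q a"
    by (metis count_le_replicate_mset_subset_eq subset_mset.diff_add)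
  then have "size M' = 1"
    using M by simp
  then obtain b where b: "M = add_mset b (replicate_mset q a)"
    using M' by (metis One_nat_def size_1_singleton_mset add_mset_add_single union_commute)
  then have ab: "a \<in> free_semigroup d" "b \<in> free_semigroup d"
    using M q by auto
  show ?thesis
  proof (cases "a = b")
    case True
    then have M_eq: "M = replicate_mset (Suc q) a"
      using b by simp
    have "word a \<in> free_algebra d"
      using ab by (intro word_in_free_algebra) (auto simp: free_semigroup_iff)
    then have "sym_gen u M v c \<in> power_ideal (Suc q) d"
      unfolding sym_gen_eq M_eq symsum_replicate
      by (intro power_ideal_single_left power_ideal_single_right power_in_power_ideal uv) auto
    then show ?thesis ..
  next
    case False
    have "(\<Sum>w\<in>#M. len w) = q * len a + len b"
      by (simp add: b image_replicate_mset sum_mset_replicate_mset)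
    moreover have "sym_gen u M v c = Poly_Mapping.single u c * lin1 (word a) (word b) q * word v"
      by (simp only: sym_gen_eq b symsum_lin1[OF False])
    ultimately show ?thesis
      using ab by blast
  qed
qed

text \<open>The bimodule property absorbs the scalar and the outer words into the linear argument.
  Degrees are recorded for the later gain in length.\<close>

lemma sym_gen_cong_lin1:
  fixes c :: "'k::{field,finite}"
  assumes q: "q \<ge> 2" "CARD('k) = q"
    and M: "size M = Suc q" "set_mset M \<subseteq> free_semigroup d"
    and uv: "u \<in> words d" "v \<in> words d"
  shows "sym_gen u M v c \<in> power_ideal (Suc q) d \<or>
    (\<exists>i\<ge>1. \<exists>j\<ge>1. \<exists>a\<in>deg_ge d i. \<exists>b\<in>deg_ge d j. len u + (\<Sum>w\<in>#M. len w) + len v = q * i + j \<and>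
      sym_gen u M v c - lin1 a b q \<in> power_ideal (Suc q) d)"
proof -
  interpret nil_ideal "free_algebra d" "power_ideal (Suc q) d :: (nat fmonoid \<Rightarrow>\<^sub>0 'k) set" q
    by (rule nil_ideal_power_ideal[OF q])
  have left: "cong (Poly_Mapping.single u c * P a b) (P a (Poly_Mapping.single u c * b))"
    if "a \<in> free_algebra d" "b \<in> free_algebra d" for a b
  proof (cases "len u \<ge> 1")
    case True
    then show ?thesis
      using that uv by (intro cong_sym[OF P_left] word_in_free_algebra)
  next
    case False
    show ?thesis
      by (simp add: word_len_zero[OF False] lin1_scale)
  qed
  have right: "cong (P a b * word v) (P a (b * word v))"
    if "a \<in> free_algebra d" "b \<in> free_algebra d" for a b
  proof (cases "len v \<ge> 1")
    case True
    then show ?thesis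
      using that uv by (intro cong_sym[OF P_right] word_in_free_algebra)
  next
    case False
    show ?thesis
      by (simp add: word_len_zero[OF False])
  qed
  show ?thesis
    using sym_gen_cases[OF assms, of c]
  proof (elim disjE bexE conjE)
    fix a b
    assume ab: "a \<in> free_semigroup d" "b \<in> free_semigroup d"
      and sum: "(\<Sum>w\<in>#M. len w) = q * len a + len b"
      and gen: "sym_gen u M v c = Poly_Mapping.single u c * P (word a) (word b) * word v"
    have wd: "a \<in> words d" "b \<in> words d" "len a \<ge> 1" "len b \<ge> 1"
      using ab by (auto simp: free_semigroup_iff)
    have A: "word a \<in> free_algebra d" "word b \<in> free_algebra d" "word (b + v) \<in> free_algebra d"
      using wd uv by (auto intro!: word_in_free_algebra)
    have "cong (P (word a) (word b) * word v) (P (word a) (word (b + v)))"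
      using right[OF A(1,2)] by (simp add: mult_single)
    then have "P (word a) (word b) * word v - P (word a) (word (b + v)) \<in> power_ideal (Suc q) d"
      by (simp add: cong_def)
    then have "Poly_Mapping.single u c * (P (word a) (word b) * word v - P (word a) (word (b + v)))
        \<in> power_ideal (Suc q) d"
      by (intro power_ideal_single_left uv) auto
    then have "cong (sym_gen u M v c) (Poly_Mapping.single u c * P (word a) (word (b + v)))"
      by (simp add: cong_def gen right_diff_distrib mult.assoc)
    also have "cong \<dots> (P (word a) (Poly_Mapping.single (u + (b + v)) c))"
      using left[OF A(1,3)] by (simp add: mult_single)
    finally have "sym_gen u M v c - P (word a) (Poly_Mapping.single (u + (b + v)) c) \<in> power_ideal (Suc q) d"
      by (simp add: cong_def)
    moreover have "word a \<in> deg_ge d (len a)"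
      "Poly_Mapping.single (u + (b + v)) c \<in> deg_ge d (len u + len b + len v)"
      using wd uv by (auto intro!: deg_ge_single)
    moreover have "len u + (\<Sum>w\<in>#M. len w) + len v = q * len a + (len u + len b + len v)"
      by (simp add: sum)
    ultimately show ?thesis
      using wd by (intro disjI2 exI[of _ "len a"] exI[of _ "len u + len b + len v"] conjI bexI) auto
  qed blast
qed

text \<open>Absorbing \<open>x\<close> into the argument of degree \<open>q\<close> raises the
  degree bound from \<open>m + s\<close> to \<open>m + q * s\<close>.\<close>

lemma sym_span_mult_deg_ge:
  fixes p :: "nat fmonoid \<Rightarrow>\<^sub>0 'k::{field,finite}"
  assumes q: "q \<ge> 2" "CARD('k) = q"
    and p: "p \<in> sym_span (Suc q) d {m}" and x: "x \<in> deg_ge d s" "s \<ge> 1"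
  shows "\<exists>r\<in>deg_ge d (m + q * s). p * x - r \<in> power_ideal (Suc q) d"
proof -
  interpret nil_ideal "free_algebra d" "power_ideal (Suc q) d :: (nat fmonoid \<Rightarrow>\<^sub>0 'k) set" q
    by (rule nil_ideal_power_ideal[OF q])
  have A: "y \<in> free_algebra d" if "y \<in> deg_ge d i" "i \<ge> 1" for y :: "nat fmonoid \<Rightarrow>\<^sub>0 'k" and i
    using deg_ge_mono that by (auto simp: free_algebra_eq)
  show ?thesis
    using p
  proof induction
    case zero
    then show ?case
      using I_zero by (intro bexI[of _ 0]) (auto simp: deg_ge_zero)
  next
    case (add p p')
    then obtain r r' where "r \<in> deg_ge d (m + q * s)" "r' \<in> deg_ge d (m + q * s)"
      "p * x - r \<in> power_ideal (Suc q) d" "p' * x - r' \<in> power_ideal (Suc q) d"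
      by blast
    then have "r + r' \<in> deg_ge d (m + q * s)"
      "(p + p') * x - (r + r') \<in> power_ideal (Suc q) d"
      using deg_ge_add I_add[of "p * x - r" "p' * x - r'"] by (auto simp: algebra_simps)
    then show ?case
      by blast
  next
    case (gen M u v c)
    from sym_gen_cong_lin1[OF assms(1,2) gen(1-4), of c] show ?case
    proof (elim disjE exE bexE conjE)
      assume "sym_gen u M v c \<in> power_ideal (Suc q) d"
      then have "sym_gen u M v c * x - 0 \<in> power_ideal (Suc q) d"
        using I_mult_right A[OF x] by simp
      then show ?thesis
        using deg_ge_zero by blast
    next
      fix i j a b
      assume ij: "1 \<le> i" "1 \<le> j" and ab: "a \<in> deg_ge d i" "b \<in> deg_ge d j"
        and sum: "len u + (\<Sum>w\<in>#M. len w) + len v = q * i + j"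
        and cong: "sym_gen u M v c - P a b \<in> power_ideal (Suc q) d"
      have "cong (sym_gen u M v c * x) (P a b * x)"
        using cong A[OF x] by (intro cong_mult_right) (simp_all add: cong_def)
      also have "cong \<dots> (P (a * x) b)"
        using A ij ab x by (intro P_mult_arg) auto
      finally have "sym_gen u M v c * x - P (a * x) b \<in> power_ideal (Suc q) d"
        by (simp add: cong_def)
      moreover have "P (a * x) b \<in> deg_ge d (q * (i + s) + j)"
        using ab x by (intro deg_ge_lin1 deg_ge_mult)
      moreover have "q * (i + s) + j = m + q * s"
        using gen(5) sum by (simp add: algebra_simps)
      ultimately show ?thesis
        by auto
    qed
  qed
qed

text \<open>Modulo the ideal both factors reduce to sums of values of \<open>P\<close>, and
  \<open>P_mult_P\<close> applies.\<close>

lemma sym_span_mult_sym_span: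
  fixes p p' :: "nat fmonoid \<Rightarrow>\<^sub>0 'k::{field,finite}"
  assumes q: "q \<ge> 2" "CARD('k) = q"
    and p: "p \<in> sym_span (Suc q) d L" and p': "p' \<in> sym_span (Suc q) d L'"
  shows "p * p' \<in> power_ideal (Suc q) d"
proof -
  interpret nil_ideal "free_algebra d" "power_ideal (Suc q) d :: (nat fmonoid \<Rightarrow>\<^sub>0 'k) set" q
    by (rule nil_ideal_power_ideal[OF q])
  have A: "y \<in> free_algebra d" if "y \<in> deg_ge d i" "i \<ge> 1" for y :: "nat fmonoid \<Rightarrow>\<^sub>0 'k" and i
    using deg_ge_mono that by (auto simp: free_algebra_eq)
  have P_in_A: "P a b \<in> free_algebra d" if "a \<in> free_algebra d" "b \<in> free_algebra d" for a b
    using deg_ge_lin1[of a d 1 b 1 q] that by (intro A) (auto simp: free_algebra_eq)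
  have *: "P a b * p' \<in> power_ideal (Suc q) d" if ab: "a \<in> free_algebra d" "b \<in> free_algebra d" for a b
    using p'
  proof induction
    case (gen M u v c)
    from sym_gen_cong_lin1[OF assms(1,2) gen(1-4), of c] show ?case
    proof (elim disjE exE bexE conjE)
      assume "sym_gen u M v c \<in> power_ideal (Suc q) d"
      then show ?thesis
        using I_mult_left P_in_A ab by blast
    next
      fix i j e f
      assume ij: "1 \<le> i" "1 \<le> j" and ef: "e \<in> deg_ge d i" "f \<in> deg_ge d j"
        and cong: "sym_gen u M v c - P e f \<in> power_ideal (Suc q) d"
      have "cong (P a b * sym_gen u M v c) (P a b * P e f)"
        using cong P_in_A[OF ab] by (intro cong_mult_left) (simp_all add: cong_def)
      then show ?thesis
        by (rule cong_I) (use P_mult_P ab A ij ef in auto)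
    qed
  qed (auto simp: distrib_left I_zero I_add)
  have p'_A: "p' \<in> free_algebra d"
    by (rule sym_span_subset[OF _ p']) simp
  show ?thesis
    using p
  proof induction
    case (gen M u v c)
    from sym_gen_cong_lin1[OF assms(1,2) gen(1-4), of c] show ?case
    proof (elim disjE exE bexE conjE)
      assume "sym_gen u M v c \<in> power_ideal (Suc q) d"
      then show ?thesis
        using I_mult_right p'_A by blast
    next
      fix i j a b
      assume ij: "1 \<le> i" "1 \<le> j" and ab: "a \<in> deg_ge d i" "b \<in> deg_ge d j"
        and cong: "sym_gen u M v c - P a b \<in> power_ideal (Suc q) d"
      have "cong (sym_gen u M v c * p') (P a b * p')"
        using cong p'_A by (intro cong_mult_right) (simp_all add: cong_def)
      then show ?thesis
        by (rule cong_I) (use * A ij ab in auto)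
    qed
  qed (auto simp: distrib_right I_zero I_add)
qed

text \<open>Over \<open>'f\<close>, words of length \<open>c\<close> are only known to lie in the
  span; a further letter starts the rewriting into longer words, whence the
  \<open>Suc\<close>.\<close>

lemma nil_words_Suc_finite_field:
  assumes q: "q \<ge> 2" "CARD('f::{field,finite}) = q" and "CHAR('l::field) = CHAR('f)"
    and "c > 0" and nil: "nil_words TYPE('l) (Suc q) d c"
  shows "nil_words TYPE('f) (Suc q) d (Suc c)"
proof -
  have char: "CHAR('l) > 0"
    using assms(3) finite_imp_CHAR_pos[where 'a = 'f] by simp
  have span: "(word w :: nat fmonoid \<Rightarrow>\<^sub>0 'f) \<in> sym_span (Suc q) d {c}"
    if "w \<in> words d" "len w = c" for w
  proof -
    have "(word w :: nat fmonoid \<Rightarrow>\<^sub>0 'l) \<in> sym_span (Suc q) d UNIV"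
      using nil that power_ideal_subset_sym_span[of "Suc q" d] by (auto simp: nil_words_def)
    from word_in_sym_span_transfer[OF assms(3) char this] show ?thesis
      using that by simp
  qed
  have "(word w :: nat fmonoid \<Rightarrow>\<^sub>0 'f) \<in> power_ideal (Suc q) d" if "w \<in> words d" "c < len w" for w
    using that
  \<comment> \<open>The rewriting lengthens words, and the measure reaches 0 at length
    \<open>2 * c\<close>, where a word begins with two factors from the span.\<close>
  proof (induction "2 * c - len w" arbitrary: w rule: less_induct)
    case less
    obtain u v where uv: "w = u + v" "u \<in> words d" "v \<in> words d" "len u = c" "len v = len w - c"
      using split_word[OF less.prems(1), of c] less.prems(2) by auto
    show ?case
    proof (cases "len w \<ge> 2 * c")
      case True
      then have "c \<le> len v"
        using uv(5) by simp
      then obtain v1 v2 where v: "v = v1 + v2" "v1 \<in> words d" "v2 \<in> words d" "len v1 = c"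
        using split_word[OF uv(3), of c] by metis
      have "word u * (word v1 :: nat fmonoid \<Rightarrow>\<^sub>0 'f) \<in> power_ideal (Suc q) d"
        by (rule sym_span_mult_sym_span[OF q]) (use span uv v in auto)
      then have "word u * word v1 * (word v2 :: nat fmonoid \<Rightarrow>\<^sub>0 'f) \<in> power_ideal (Suc q) d"
        by (rule power_ideal_single_right[OF zero_less_Suc v(3)])
      then show ?thesis
        by (simp add: uv(1) v(1) mult_single add.assoc)
    next
      case False
      let ?s = "len w - c"
      have v: "(word v :: nat fmonoid \<Rightarrow>\<^sub>0 'f) \<in> deg_ge d ?s"
        using uv by (intro deg_ge_single) auto
      have "?s \<ge> 1"
        using less.prems by simp
      from sym_span_mult_deg_ge[OF q span[OF uv(2,4)] v this]
      obtain r :: "nat fmonoid \<Rightarrow>\<^sub>0 'f" where r: "r \<in> deg_ge d (c + q * ?s)"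
        "word u * word v - r \<in> power_ideal (Suc q) d"
        by blast
      \<comment> \<open>With \<open>?s \<ge> 1\<close>, doubling \<open>?s\<close> gives words
        strictly longer than \<open>w\<close>, as the induction requires.\<close>
      have "2 * ?s \<le> q * ?s"
        using q by simp
      then have longer: "len w < c + q * ?s"
        using less.prems by linarith
      have "(word v' :: nat fmonoid \<Rightarrow>\<^sub>0 'f) \<in> power_ideal (Suc q) d"
        if "v' \<in> words d" "c + q * ?s \<le> len v'" for v'
        using that longer False less.prems by (intro less.hyps) linarith+
      then have "r \<in> power_ideal (Suc q) d"
        by (rule deg_ge_subset_power_ideal[OF zero_less_Suc _ r(1)])
      then have "word u * (word v :: nat fmonoid \<Rightarrow>\<^sub>0 'f) \<in> power_ideal (Suc q) d"
        using power_ideal_add[OF _ r(2), of r] by simp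
      then show ?thesis
        by (simp add: uv(1) mult_single)
    qed
  qed
  then show ?thesis
    by (simp add: nil_words_def)
qed

theorem theorem4p1:
  fixes n d :: nat
  assumes "n \<ge> 2" and "d \<ge> 2"
    and "CARD('f::{field, finite}) = n - 1"
    and "infinite (UNIV :: 'l::field set)"
    and "CHAR('l) = CHAR('f)"
  shows "nilpotency_degree TYPE('l) n d \<le> nilpotency_degree TYPE('f) n d \<and>
    nilpotency_degree TYPE('f) n d \<le> nilpotency_degree TYPE('l) n d + 1"
proof -
  define q where "q = CARD('f)"
  have n: "n = Suc q"
    using assms(1,3) by (simp add: q_def)
  \<comment> \<open>The distinct elements 0 and 1 force \<open>q \<ge> 2\<close>, hence
    \<open>n \<ge> 3\<close>.\<close>
  have "card {0, 1::'f} \<le> q"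
    unfolding q_def by (rule card_mono) auto
  then have q: "q \<ge> 2" "CARD('f) = q"
    by (auto simp: q_def)
  have char: "CHAR('f) > 0"
    by (rule finite_imp_CHAR_pos) simp
  define F where "F c \<longleftrightarrow> c > 0 \<and> nil_words TYPE('f) n d c" for c
  define L where "L c \<longleftrightarrow> c > 0 \<and> nil_words TYPE('l) n d c" for c
  have deg: "nilpotency_degree TYPE('f) n d = (LEAST c. F c)"
    "nilpotency_degree TYPE('l) n d = (LEAST c. L c)"
    unfolding F_def L_def by (simp_all add: nilpotency_degree_eq n)
  have FL: "F c \<Longrightarrow> L c" for c
    unfolding F_def L_def
    using nil_words_infinite_field[OF _ assms(4) assms(5)[symmetric] char, of n d c] n by auto
  have LF: "L c \<Longrightarrow> F (Suc c)" for c
    unfolding F_def L_def n using nil_words_Suc_finite_field[OF q assms(5)] by auto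
  show ?thesis
  proof (cases "\<exists>c. L c")
    case True
    then have "L (LEAST c. L c)"
      by (auto intro: LeastI)
    then have "F (Suc (LEAST c. L c))"
      by (rule LF)
    moreover from this have "L (LEAST c. F c)"
      by (intro FL) (rule LeastI)
    ultimately show ?thesis
      unfolding deg by (auto intro: Least_le)
  next
    \<comment> \<open>\<open>LEAST\<close> is unspecified on an empty predicate, but then both predicates are the same.\<close>
    case False
    then have "F = L"
      using FL by blast
    then show ?thesis
      unfolding deg by simp
  qed
qed

end
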